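(* We have that $\Delta_0^{p-1}=(-1)^n\Delta$ and $\psi_{i-1}=-\dfrac{\Delta_i}{\Delta_0}$ for $1\le i\le n$.
   Context: Let $\Bbbk$ be an algebraically closed field of characteristic $p>2$, let $n\ge 1$, and assume $(p,n)\ne(3,1)$. Let $\mathcal{O}_n=\Bbbk[X_1,\ldots,X_n]/(X_1^p,\ldots,X_n^p)$, let $x_i$ be the image of $X_i$, and let $\mathfrak{m}=(x_1,\ldots,x_n)$ be the maximal ideal of $\mathcal{O}_n$. For $f\in\mathcal{O}_n$ let $f(0)\in\Bbbk$ be the unique scalar with $f-f(0)\in\mathfrak{m}$. Let $\mathcal{L}=\mathrm{Der}(\mathcal{O}_n)$ be the Lie algebra of $\Bbbk$-linear derivations of $\mathcal{O}_n$, a free $\mathcal{O}_n$-module with basis $\partial_1,\ldots,\partial_n$, where $\partial_i(x_j)=\delta_{ij}$; for $D\in\mathcal{L}$ all powers $D^{p^k}$ (as endomorphisms of $\mathcal{O}_n$) again lie in $\mathcal{L}$. It is known (Premet) that for every $x\in\mathcal{L}$ one has $\det(tI_{\mathcal{O}_n}-x)=t^{p^n}+\sum_{i=0}^{n-1}\psi_i(x)t^{p^i}$, which defines homogeneous polynomial functions $\psi_0,\ldots,\psi_{n-1}\in\Bbbk[\mathcal{L}]$. Define $\Delta\in\Bbbk[\mathcal{L}]$ by $\Delta(D)=\big(D^{p^n-1}(x_1^{p-1}\cdots x_n^{p-1})\big)(0)$ for $D\in\mathcal{L}$. Give $\mathcal{L}$ the $\mathbb{Z}$-grading $\mathcal{L}=\bigoplus_{i\ge-1}\mathcal{L}_i$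 in which $x_1^{a_1}\cdots x_n^{a_n}\partial_j$ (with $0\le a_k\le p-1$) has degree $a_1+\cdots+a_n-1$, and give the exterior power $\wedge^n\mathcal{L}$ (over $\Bbbk$) the induced grading $\wedge^n\mathcal{L}=\bigoplus_{i\ge-n}(\wedge^n\mathcal{L})_i$, so that $(\wedge^n\mathcal{L})_{-n}=\Bbbk(\partial_1\wedge\cdots\wedge\partial_n)$. Define homogeneous polynomial functions $\Delta_0,\Delta_1,\ldots,\Delta_n\in\Bbbk[\mathcal{L}]$ by requiring, for all $D\in\mathcal{L}$, $$D\wedge D^p\wedge\cdots\wedge D^{p^{n-1}}\in\Delta_0(D)(\partial_1\wedge\cdots\wedge\partial_n)+\bigoplus_{i>-n}(\wedge^n\mathcal{L})_i,$$ and, for $1\le i\le n$, $$D\wedge\cdots\wedge D^{p^{i-2}}\wedge D^{p^n}\wedge D^{p^{i}}\wedge\cdots\wedge D^{p^{n-1}}\in\Delta_i(D)(\partial_1\wedge\cdots\wedge\partial_n)+\bigoplus_{j>-n}(\wedge^n\mathcal{L})_j,$$ where the left-hand side is obtained from $D\wedge D^p\wedge\cdots\wedge D^{p^{n-1}}$ by replacing the $i$-th factor $D^{p^{i-1}}$ by $D^{p^n}$. *)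

theory Defs
  imports
    "HOL-Library.Cardinality"
    "HOL-Library.Poly_Mapping"
    "HOL-Computational_Algebra.Computational_Algebra"
    "Jordan_Normal_Form.Char_Poly"
begin

text \<open>
  The polynomial ring over a field \<open>'a\<close> in variables indexed by a finite type \<open>'n\<close> is
  \<open>('n \<Rightarrow>\<^sub>0 nat) \<Rightarrow>\<^sub>0 'a\<close>.  The prime \<open>p\<close> is \<open>CHAR('a)\<close>, which the class \<open>field_prime_char\<close>
  makes positive.
\<close>

definition pvar :: "'n \<Rightarrow> ('n \<Rightarrow>\<^sub>0 nat) \<Rightarrow>\<^sub>0 'a::comm_ring_1" where
  "pvar i = Poly_Mapping.single (Poly_Mapping.single i 1) 1"

definition trunc_ideal :: "(('n::finite \<Rightarrow>\<^sub>0 nat) \<Rightarrow>\<^sub>0 'a::comm_ring_1) set" where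
  "trunc_ideal = range (\<lambda>g. \<Sum>i\<in>UNIV. g i * pvar i ^ CHAR('a))"

lemma trunc_ideal_0: "0 \<in> trunc_ideal"
  unfolding trunc_ideal_def by (rule range_eqI[of _ _ "\<lambda>_. 0"]) simp

lemma trunc_ideal_add:
  assumes "f \<in> trunc_ideal" "g \<in> trunc_ideal" shows "f + g \<in> trunc_ideal"
proof -
  obtain a b where "f = (\<Sum>i\<in>UNIV. a i * pvar i ^ CHAR('b))"
    "g = (\<Sum>i\<in>UNIV. b i * pvar i ^ CHAR('b))"
    using assms unfolding trunc_ideal_def by blast
  then have "f + g = (\<Sum>i\<in>UNIV. (a i + b i) * pvar i ^ CHAR('b))"
    by (simp add: sum.distrib distrib_right)
  then show ?thesis
    unfolding trunc_ideal_def by (intro range_eqI[of _ _ "\<lambda>i. a i + b i"])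
qed

lemma trunc_ideal_mult:
  assumes "f \<in> trunc_ideal" shows "h * f \<in> trunc_ideal"
proof -
  obtain a where "f = (\<Sum>i\<in>UNIV. a i * pvar i ^ CHAR('b))"
    using assms unfolding trunc_ideal_def by blast
  then have "h * f = (\<Sum>i\<in>UNIV. (h * a i) * pvar i ^ CHAR('b))"
    by (simp add: sum_distrib_left mult.assoc)
  then show ?thesis
    unfolding trunc_ideal_def by (intro range_eqI[of _ _ "\<lambda>i. h * a i"])
qed

lemma trunc_ideal_minus:
  assumes "f \<in> trunc_ideal" shows "- f \<in> trunc_ideal"
  using trunc_ideal_mult[OF assms, of "-1"] by simp

lemma trunc_ideal_diff:
  assumes "f \<in> trunc_ideal" "g \<in> trunc_ideal" shows "f - g \<in> trunc_ideal"
  using trunc_ideal_add[OF assms(1) trunc_ideal_minus[OF assms(2)]] by simp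

lemma lookup_times_at_0:
  fixes f g :: "('n \<Rightarrow>\<^sub>0 nat) \<Rightarrow>\<^sub>0 'a::comm_ring_1"
  shows "Poly_Mapping.lookup (f * g) 0 = Poly_Mapping.lookup f 0 * Poly_Mapping.lookup g 0"
proof -
  have zero_iff: "0 = l + q \<longleftrightarrow> l = 0 \<and> q = 0" for l q :: "'n \<Rightarrow>\<^sub>0 nat"
    by (auto simp: poly_mapping_eq_iff fun_eq_iff lookup_add)
  have inner: "(\<Sum>q. Poly_Mapping.lookup g q when 0 = l + q) = (Poly_Mapping.lookup g 0 when l = 0)" for l
    by (simp add: zero_iff when_def if_distrib cong: if_cong)
  show ?thesis
    unfolding times_poly_mapping.rep_eq prod_fun_def inner
    by (simp add: when_def if_distrib cong: if_cong)
qed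

lemma one_notin_trunc_ideal:
  "(1 :: ('n::finite \<Rightarrow>\<^sub>0 nat) \<Rightarrow>\<^sub>0 'a::field_prime_char) \<notin> trunc_ideal"
proof
  assume "(1 :: ('n \<Rightarrow>\<^sub>0 nat) \<Rightarrow>\<^sub>0 'a) \<in> trunc_ideal"
  then obtain g where g: "(1 :: ('n \<Rightarrow>\<^sub>0 nat) \<Rightarrow>\<^sub>0 'a) = (\<Sum>i\<in>UNIV. g i * pvar i ^ CHAR('a))"
    unfolding trunc_ideal_def by blast
  have nz: "Poly_Mapping.single i (Suc 0) \<noteq> 0" for i :: 'n
    by (metis lookup_single_eq lookup_zero nat.distinct(1))
  have pv: "Poly_Mapping.lookup (pvar i ^ CHAR('a) :: ('n \<Rightarrow>\<^sub>0 nat) \<Rightarrow>\<^sub>0 'a) 0 = 0" for i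
  proof -
    obtain m where "CHAR('a) = Suc m"
      using CHAR_pos[where ?'a = 'a] gr0_implies_Suc by blast
    moreover have "Poly_Mapping.lookup (pvar i :: ('n \<Rightarrow>\<^sub>0 nat) \<Rightarrow>\<^sub>0 'a) 0 = 0"
      using nz[of i] by (simp add: pvar_def lookup_single when_def)
    ultimately show ?thesis
      by (simp add: lookup_times_at_0)
  qed
  have "Poly_Mapping.lookup (1 :: ('n \<Rightarrow>\<^sub>0 nat) \<Rightarrow>\<^sub>0 'a) 0 = 0"
    unfolding g by (simp add: lookup_sum lookup_times_at_0 pv)
  then show False by simp
qed

definition trunc_rel ::
    "(('n::finite \<Rightarrow>\<^sub>0 nat) \<Rightarrow>\<^sub>0 'a::field_prime_char) \<Rightarrow> (('n \<Rightarrow>\<^sub>0 nat) \<Rightarrow>\<^sub>0 'a) \<Rightarrow> bool" where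
  "trunc_rel f g \<longleftrightarrow> f - g \<in> trunc_ideal"

lemma equivp_trunc_rel:
  "equivp (trunc_rel :: (('n::finite \<Rightarrow>\<^sub>0 nat) \<Rightarrow>\<^sub>0 'a::field_prime_char) \<Rightarrow> _)"
proof (rule equivpI)
  show "reflp (trunc_rel :: (('n \<Rightarrow>\<^sub>0 nat) \<Rightarrow>\<^sub>0 'a) \<Rightarrow> _)"
    by (simp add: reflp_def trunc_rel_def trunc_ideal_0)
  show "symp (trunc_rel :: (('n \<Rightarrow>\<^sub>0 nat) \<Rightarrow>\<^sub>0 'a) \<Rightarrow> _)"
  proof (rule sympI)
    fix f g :: "('n \<Rightarrow>\<^sub>0 nat) \<Rightarrow>\<^sub>0 'a"
    assume "trunc_rel f g"
    then show "trunc_rel g f"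
      using trunc_ideal_minus[of "f - g"] by (simp add: trunc_rel_def)
  qed
  show "transp (trunc_rel :: (('n \<Rightarrow>\<^sub>0 nat) \<Rightarrow>\<^sub>0 'a) \<Rightarrow> _)"
  proof (rule transpI)
    fix f g h :: "('n \<Rightarrow>\<^sub>0 nat) \<Rightarrow>\<^sub>0 'a"
    assume "trunc_rel f g" "trunc_rel g h"
    then show "trunc_rel f h"
      using trunc_ideal_add[of "f - g" "g - h"] by (simp add: trunc_rel_def)
  qed
qed

quotient_type (overloaded) ('a, 'n) trunc =
    "('n::finite \<Rightarrow>\<^sub>0 nat) \<Rightarrow>\<^sub>0 'a::field_prime_char" / trunc_rel
  by (rule equivp_trunc_rel)

instantiation trunc :: (field_prime_char, finite) comm_ring_1
begin

lift_definition zero_trunc :: "('a, 'b) trunc" is 0 .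
lift_definition one_trunc :: "('a, 'b) trunc" is 1 .
lift_definition uminus_trunc :: "('a, 'b) trunc \<Rightarrow> ('a, 'b) trunc" is uminus
proof -
  fix f f' :: "('b \<Rightarrow>\<^sub>0 nat) \<Rightarrow>\<^sub>0 'a"
  assume "trunc_rel f f'"
  then show "trunc_rel (- f) (- f')"
    unfolding trunc_rel_def using trunc_ideal_minus[of "f - f'"] by simp
qed
lift_definition plus_trunc :: "('a, 'b) trunc \<Rightarrow> ('a, 'b) trunc \<Rightarrow> ('a, 'b) trunc" is "(+)"
proof -
  fix f f' g g' :: "('b \<Rightarrow>\<^sub>0 nat) \<Rightarrow>\<^sub>0 'a"
  assume a: "trunc_rel f f'" "trunc_rel g g'"
  have "f + g - (f' + g') = (f - f') + (g - g')"
    by (simp add: algebra_simps)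
  then show "trunc_rel (f + g) (f' + g')"
    using a trunc_ideal_add[of "f - f'" "g - g'"] by (simp only: trunc_rel_def)
qed
lift_definition minus_trunc :: "('a, 'b) trunc \<Rightarrow> ('a, 'b) trunc \<Rightarrow> ('a, 'b) trunc" is "(-)"
proof -
  fix f f' g g' :: "('b \<Rightarrow>\<^sub>0 nat) \<Rightarrow>\<^sub>0 'a"
  assume a: "trunc_rel f f'" "trunc_rel g g'"
  have "f - g - (f' - g') = (f - f') - (g - g')"
    by (simp add: algebra_simps)
  then show "trunc_rel (f - g) (f' - g')"
    using a trunc_ideal_diff[of "f - f'" "g - g'"] by (simp only: trunc_rel_def)
qed
lift_definition times_trunc :: "('a, 'b) trunc \<Rightarrow> ('a, 'b) trunc \<Rightarrow> ('a, 'b) trunc" is "(*)"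
proof -
  fix f f' g g' :: "('b \<Rightarrow>\<^sub>0 nat) \<Rightarrow>\<^sub>0 'a"
  assume a: "trunc_rel f f'" "trunc_rel g g'"
  have "f * g - f' * g' = g * (f - f') + f' * (g - g')"
    by (simp add: algebra_simps)
  then show "trunc_rel (f * g) (f' * g')"
    using a unfolding trunc_rel_def by (simp add: trunc_ideal_add trunc_ideal_mult)
qed

instance
proof
  fix a b c :: "('a, 'b) trunc"
  show "a * b * c = a * (b * c)"
    by transfer (simp add: trunc_rel_def trunc_ideal_0 mult.assoc)
  show "a * b = b * a"
    by transfer (simp add: trunc_rel_def trunc_ideal_0 mult.commute)
  show "1 * a = a"
    by transfer (simp add: trunc_rel_def trunc_ideal_0)
  show "a + b + c = a + (b + c)"
    by transfer (simp add: trunc_rel_def trunc_ideal_0 add.assoc)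
  show "a + b = b + a"
    by transfer (simp add: trunc_rel_def trunc_ideal_0 add.commute)
  show "0 + a = a"
    by transfer (simp add: trunc_rel_def trunc_ideal_0)
  show "- a + a = 0"
    by transfer (simp add: trunc_rel_def trunc_ideal_0)
  show "a - b = a + - b"
    by transfer (simp add: trunc_rel_def trunc_ideal_0)
  show "(a + b) * c = a * c + b * c"
    by transfer (simp add: trunc_rel_def trunc_ideal_0 algebra_simps)
  show "(0 :: ('a, 'b) trunc) \<noteq> 1"
  proof (transfer, rule notI)
    assume "trunc_rel (0 :: ('b \<Rightarrow>\<^sub>0 nat) \<Rightarrow>\<^sub>0 'a) 1"
    then show False
      using trunc_ideal_minus[of "- 1 :: ('b \<Rightarrow>\<^sub>0 nat) \<Rightarrow>\<^sub>0 'a"] one_notin_trunc_ideal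
      by (auto simp: trunc_rel_def)
  qed
qed

end

lift_definition tvar :: "'n::finite \<Rightarrow> ('a::field_prime_char, 'n) trunc" is pvar .

lift_definition tconst :: "'a::field_prime_char \<Rightarrow> ('a, 'n::finite) trunc" is
  "Poly_Mapping.single 0" .

definition tscale :: "'a::field_prime_char \<Rightarrow> ('a, 'n::finite) trunc \<Rightarrow> ('a, 'n) trunc" where
  "tscale c f = tconst c * f"

lemma tconst_add: "tconst (a + b) = tconst a + tconst b"
  by transfer (simp add: trunc_rel_def trunc_ideal_0 single_add)

lemma tconst_mult: "tconst (a * b) = tconst a * tconst b"
  by transfer (simp add: trunc_rel_def trunc_ideal_0 mult_single)

lemma tconst_1: "tconst 1 = 1"
  by transfer (simp add: trunc_rel_def trunc_ideal_0)

lemma tconst_0: "tconst 0 = (0 :: ('a::field_prime_char, 'n::finite) trunc)"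
  using tconst_add[of "0 :: 'a" 0, where ?'b = 'n] by simp

interpretation trunc: vector_space tscale
  by unfold_locales (simp_all add: tscale_def tconst_add tconst_mult tconst_1 algebra_simps)

definition tmonom :: "('n \<Rightarrow> nat) \<Rightarrow> ('a::field_prime_char, 'n::finite) trunc" where
  "tmonom a = (\<Prod>i\<in>UNIV. tvar i ^ a i)"

definition max_ideal :: "('a::field_prime_char, 'n::finite) trunc set" where
  "max_ideal = range (\<lambda>g. \<Sum>i\<in>UNIV. g i * tvar i)"

definition eval0 :: "('a::field_prime_char, 'n::finite) trunc \<Rightarrow> 'a" where
  "eval0 f = (THE c. f - tconst c \<in> max_ideal)"

lemma mult_tscale:
  "h * tscale c f = tscale c (h * f)" "tscale c f * h = tscale c (f * h)"
  by (simp_all add: tscale_def algebra_simps)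

text \<open>
  The polynomial \<open>det (t I - T)\<close> of a linear endomorphism \<open>T\<close>, computed in an arbitrary
  ordered basis.
\<close>

definition endo_char_poly ::
    "(('a::field_prime_char, 'n::finite) trunc \<Rightarrow> ('a, 'n) trunc) \<Rightarrow> 'a poly" where
  "endo_char_poly T =
    (let bs = (SOME bs. distinct bs \<and> trunc.independent (set bs) \<and> trunc.span (set bs) = UNIV)
     in char_poly (mat (length bs) (length bs)
          (\<lambda>(i, j). trunc.representation (set bs) (T (bs ! j)) (bs ! i))))"

definition is_derivation ::
    "(('a::field_prime_char, 'n::finite) trunc \<Rightarrow> ('a, 'n) trunc) \<Rightarrow> bool" where
  "is_derivation D \<longleftrightarrow>
    Vector_Spaces.linear tscale tscale D \<and> (\<forall>f g. D (f * g) = f * D g + D f * g)"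

lemma is_derivation_iff:
  "is_derivation D \<longleftrightarrow> (\<forall>f g. D (f + g) = D f + D g) \<and> (\<forall>c f. D (tscale c f) = tscale c (D f))
     \<and> (\<forall>f g. D (f * g) = f * D g + D f * g)"
  unfolding is_derivation_def Vector_Spaces.linear_iff
  by (auto simp: trunc.vector_space_axioms)

lemmas derivation_simps = is_derivation_iff trunc.scale_right_distrib
  trunc.scale_right_diff_distrib trunc.scale_scale mult_tscale algebra_simps

typedef (overloaded) ('a, 'n) witt =
    "{D :: ('a::field_prime_char, 'n::finite) trunc \<Rightarrow> ('a, 'n) trunc. is_derivation D}"
  morphisms der_apply Abs_witt
  by (rule exI[of _ "\<lambda>_. 0"]) (simp add: is_derivation_iff tscale_def)

setup_lifting type_definition_witt

instantiation witt :: (field_prime_char, finite) ab_group_add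
begin

lift_definition zero_witt :: "('a, 'b) witt" is "\<lambda>_. 0"
  by (simp add: is_derivation_iff tscale_def)
lift_definition plus_witt :: "('a, 'b) witt \<Rightarrow> ('a, 'b) witt \<Rightarrow> ('a, 'b) witt" is
  "\<lambda>D E f. D f + E f"
  by (simp add: derivation_simps)
lift_definition uminus_witt :: "('a, 'b) witt \<Rightarrow> ('a, 'b) witt" is "\<lambda>D f. - D f"
  by (simp add: derivation_simps)
lift_definition minus_witt :: "('a, 'b) witt \<Rightarrow> ('a, 'b) witt \<Rightarrow> ('a, 'b) witt" is
  "\<lambda>D E f. D f - E f"
  by (simp add: derivation_simps)

instance
  by standard (transfer; simp add: fun_eq_iff algebra_simps)+

end

lift_definition wscale ::
    "'a::field_prime_char \<Rightarrow> ('a, 'n::finite) witt \<Rightarrow> ('a, 'n) witt" is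
  "\<lambda>c D f. tscale c (D f)"
  by (simp add: derivation_simps)

interpretation witt: vector_space wscale
  by unfold_locales (transfer; simp add: fun_eq_iff tscale_def tconst_add tconst_mult tconst_1
    algebra_simps)+

definition wmult ::
    "('a::field_prime_char, 'n::finite) trunc \<Rightarrow> ('a, 'n) witt \<Rightarrow> ('a, 'n) witt" where
  "wmult h D = Abs_witt (\<lambda>f. h * der_apply D f)"

lemma der_apply_wmult [simp]: "der_apply (wmult h D) f = h * der_apply D f"
proof -
  have "is_derivation (\<lambda>f. h * der_apply D f)"
    using der_apply[of D] by (simp add: derivation_simps)
  then show ?thesis by (simp add: wmult_def Abs_witt_inverse)
qed

lemma of_nat_CHAR_trunc: "of_nat CHAR('a) = (0 :: ('a::field_prime_char, 'n::finite) trunc)"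
proof -
  have "of_nat m = (tconst (of_nat m) :: ('a, 'n) trunc)" for m
    by (induction m) (simp_all add: tconst_0 tconst_add tconst_1)
  from this[of "CHAR('a)"] show ?thesis by (simp add: tconst_0)
qed

lemma Leibniz_funpow:
  assumes "is_derivation D"
  shows "(D ^^ m) (f * g) = (\<Sum>k\<le>m. of_nat (m choose k) * ((D ^^ k) f * (D ^^ (m - k)) g))"
proof (induction m)
  case 0
  show ?case by simp
next
  case (Suc m)
  have add: "D (a + b) = D a + D b" and mult: "D (a * b) = a * D b + D a * b" for a b
    using assms by (auto simp: is_derivation_iff)
  have zero: "D 0 = 0" using add[of 0 0] by simp
  have sum: "D (\<Sum>k\<in>A. h k) = (\<Sum>k\<in>A. D (h k))" if "finite A" for A :: "nat set" and h
    using that by (induction A rule: finite_induct) (simp_all add: add zero)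
  have one: "D 1 = 0" using mult[of 1 1] by simp
  have nat: "D (of_nat j) = 0" for j :: nat
    by (induction j) (simp_all add: add zero one)
  let ?t = "\<lambda>k. (D ^^ k) f * (D ^^ (Suc m - k)) g"
  have "(D ^^ Suc m) (f * g) =
      (\<Sum>k\<le>m. of_nat (m choose k) * ((D ^^ k) f * (D ^^ Suc (m - k)) g
                                       + (D ^^ Suc k) f * (D ^^ (m - k)) g))"
    by (simp add: Suc sum mult nat)
  also have "\<dots> = (\<Sum>k\<le>m. of_nat (m choose k) * ?t k) + (\<Sum>k\<le>m. of_nat (m choose k) * ?t (Suc k))"
    by (simp add: sum.distrib distrib_left Suc_diff_le)
  also have "(\<Sum>k\<le>m. of_nat (m choose k) * ?t k) =
      ?t 0 + (\<Sum>k\<le>m. of_nat (m choose Suc k) * ?t (Suc k))"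
  proof -
    have "(\<Sum>k\<le>m. of_nat (m choose k) * ?t k) = (\<Sum>k\<le>Suc m. of_nat (m choose k) * ?t k)"
      by (simp add: binomial_eq_0)
    also have "\<dots> = ?t 0 + (\<Sum>k\<le>m. of_nat (m choose Suc k) * ?t (Suc k))"
      by (simp only: sum.atMost_Suc_shift) simp
    finally show ?thesis .
  qed
  also have "?t 0 + (\<Sum>k\<le>m. of_nat (m choose Suc k) * ?t (Suc k))
        + (\<Sum>k\<le>m. of_nat (m choose k) * ?t (Suc k))
      = ?t 0 + (\<Sum>k\<le>m. of_nat (Suc m choose Suc k) * ?t (Suc k))"
    by (simp add: sum.distrib algebra_simps)
  also have "\<dots> = (\<Sum>k\<le>Suc m. of_nat (Suc m choose k) * ?t k)"
    by (simp only: sum.atMost_Suc_shift) simp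
  finally show ?case .
qed

lemma is_derivation_funpow_CHAR:
  fixes D :: "('a::field_prime_char, 'n::finite) trunc \<Rightarrow> ('a, 'n) trunc"
  assumes D: "is_derivation D"
  shows "is_derivation (D ^^ CHAR('a))"
proof -
  let ?p = "CHAR('a)"
  have p: "prime ?p" by (rule prime_CHAR_semidom) (simp add: CHAR_pos)
  have "(D ^^ m) (f + g) = (D ^^ m) f + (D ^^ m) g" for m f g
    using D by (induction m) (simp_all add: is_derivation_iff)
  moreover have "(D ^^ m) (tscale c f) = tscale c ((D ^^ m) f)" for m c f
    using D by (induction m) (simp_all add: is_derivation_iff)
  moreover have "(D ^^ ?p) (f * g) = f * (D ^^ ?p) g + (D ^^ ?p) f * g" for f g
  proof -
    let ?t = "\<lambda>k. of_nat (?p choose k) * ((D ^^ k) f * (D ^^ (?p - k)) g)"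
    have "?t k = 0" if "k \<in> {..?p} - {0, ?p}" for k
    proof -
      have "?p dvd (?p choose k)"
        using that p by (intro dvd_choose_prime) auto
      then obtain q where "?p choose k = ?p * q" by blast
      then show ?thesis by (simp add: of_nat_CHAR_trunc)
    qed
    then have "(\<Sum>k\<le>?p. ?t k) = (\<Sum>k\<in>{0, ?p}. ?t k)"
      by (intro sum.mono_neutral_right) auto
    also have "\<dots> = f * (D ^^ ?p) g + (D ^^ ?p) f * g"
      using CHAR_pos[where ?'a = 'a] by simp
    finally show ?thesis by (simp add: Leibniz_funpow[OF D])
  qed
  ultimately show ?thesis by (simp add: is_derivation_iff)
qed

lift_definition ppow ::
    "nat \<Rightarrow> ('a::field_prime_char, 'n::finite) witt \<Rightarrow> ('a, 'n) witt" is
  "\<lambda>k D. D ^^ (CHAR('a) ^ k)"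
proof -
  fix k and D :: "('a, 'n) trunc \<Rightarrow> ('a, 'n) trunc"
  assume "is_derivation D"
  then show "is_derivation (D ^^ (CHAR('a) ^ k))"
  proof (induction k)
    case (Suc k)
    then have "is_derivation ((D ^^ (CHAR('a) ^ k)) ^^ CHAR('a))"
      by (simp add: is_derivation_funpow_CHAR)
    then show ?case by (simp add: funpow_mult mult.commute)
  qed simp
qed

definition partial :: "'n::finite \<Rightarrow> ('a::field_prime_char, 'n) witt" where
  "partial j = (THE D. \<forall>i. der_apply D (tvar i) = (if i = j then 1 else 0))"

definition witt_grade :: "int \<Rightarrow> ('a::field_prime_char, 'n::finite) witt set" where
  "witt_grade d = witt.span {wmult (tmonom a) (partial j) | a j.
     (\<forall>k. a k \<le> CHAR('a) - 1) \<and> (\<Sum>k\<in>UNIV. int (a k)) - 1 = d}"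

text \<open>
  As a vector space, the exterior algebra is the quotient of the free vector space on all tuples
  (lists) of vectors by the span of the relations expressing that the wedge product is
  multilinear and alternating.  All relations are homogeneous in the length of the tuples, so the
  \<open>m\<close>-th exterior power is the subspace spanned by the wedges of lists of length \<open>m\<close>.
\<close>

definition fscale :: "'a::field \<Rightarrow> ('b \<Rightarrow>\<^sub>0 'a) \<Rightarrow> ('b \<Rightarrow>\<^sub>0 'a)" where
  "fscale c = Poly_Mapping.map ((*) c)"

lemma lookup_fscale [simp]: "Poly_Mapping.lookup (fscale c f) k = c * Poly_Mapping.lookup f k"
  by (simp add: fscale_def map.rep_eq when_def)

interpretation free: vector_space fscale
  by unfold_locales (auto intro!: poly_mapping_eqI simp: lookup_add algebra_simps)

definition ext_relations ::
    "((('a::field_prime_char, 'n::finite) witt list) \<Rightarrow>\<^sub>0 'a) set" where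
  "ext_relations =
    {Poly_Mapping.single (us @ (wscale a x + wscale b y) # vs) 1
       - fscale a (Poly_Mapping.single (us @ x # vs) 1)
       - fscale b (Poly_Mapping.single (us @ y # vs) 1) | us vs a b x y. True}
    \<union> {Poly_Mapping.single us 1 | us. \<not> distinct us}"

definition ext_rel ::
    "((('a::field_prime_char, 'n::finite) witt list) \<Rightarrow>\<^sub>0 'a) \<Rightarrow> (('a, 'n) witt list \<Rightarrow>\<^sub>0 'a) \<Rightarrow> bool"
  where "ext_rel u v \<longleftrightarrow> u - v \<in> free.span ext_relations"

lemma equivp_ext_rel:
  "equivp (ext_rel :: (('a::field_prime_char, 'n::finite) witt list \<Rightarrow>\<^sub>0 'a) \<Rightarrow> _)"
proof (rule equivpI)
  show "reflp (ext_rel :: (('a, 'n) witt list \<Rightarrow>\<^sub>0 'a) \<Rightarrow> _)"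
    by (simp add: reflp_def ext_rel_def free.span_zero)
  show "symp (ext_rel :: (('a, 'n) witt list \<Rightarrow>\<^sub>0 'a) \<Rightarrow> _)"
  proof (rule sympI)
    fix u v :: "('a, 'n) witt list \<Rightarrow>\<^sub>0 'a"
    assume "ext_rel u v"
    then show "ext_rel v u"
      using free.span_neg[of "u - v"] by (simp add: ext_rel_def)
  qed
  show "transp (ext_rel :: (('a, 'n) witt list \<Rightarrow>\<^sub>0 'a) \<Rightarrow> _)"
  proof (rule transpI)
    fix u v w :: "('a, 'n) witt list \<Rightarrow>\<^sub>0 'a"
    assume "ext_rel u v" "ext_rel v w"
    then show "ext_rel u w"
      using free.span_add[of "u - v" _ "v - w"] by (simp add: ext_rel_def)
  qed
qed

quotient_type (overloaded) ('a, 'n) ext =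
    "(('a::field_prime_char, 'n::finite) witt list) \<Rightarrow>\<^sub>0 'a" / ext_rel
  by (rule equivp_ext_rel)

instantiation ext :: (field_prime_char, finite) ab_group_add
begin

lift_definition zero_ext :: "('a, 'b) ext" is 0 .
lift_definition uminus_ext :: "('a, 'b) ext \<Rightarrow> ('a, 'b) ext" is uminus
proof -
  fix f f' :: "('a, 'b) witt list \<Rightarrow>\<^sub>0 'a"
  assume "ext_rel f f'"
  then show "ext_rel (- f) (- f')"
    unfolding ext_rel_def using free.span_neg[of "f - f'"] by simp
qed
lift_definition plus_ext :: "('a, 'b) ext \<Rightarrow> ('a, 'b) ext \<Rightarrow> ('a, 'b) ext" is "(+)"
proof -
  fix f f' g g' :: "('a, 'b) witt list \<Rightarrow>\<^sub>0 'a"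
  assume a: "ext_rel f f'" "ext_rel g g'"
  have "f + g - (f' + g') = (f - f') + (g - g')"
    by (simp add: algebra_simps)
  then show "ext_rel (f + g) (f' + g')"
    using a free.span_add[of "f - f'" _ "g - g'"] by (simp only: ext_rel_def)
qed
lift_definition minus_ext :: "('a, 'b) ext \<Rightarrow> ('a, 'b) ext \<Rightarrow> ('a, 'b) ext" is "(-)"
proof -
  fix f f' g g' :: "('a, 'b) witt list \<Rightarrow>\<^sub>0 'a"
  assume a: "ext_rel f f'" "ext_rel g g'"
  have "f - g - (f' - g') = (f - f') - (g - g')"
    by (simp add: algebra_simps)
  then show "ext_rel (f - g) (f' - g')"
    using a free.span_diff[of "f - f'" _ "g - g'"] by (simp only: ext_rel_def)
qed

instance
  by standard (transfer; simp add: ext_rel_def free.span_zero algebra_simps)+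

end

lift_definition ext_scale ::
    "'a::field_prime_char \<Rightarrow> ('a, 'n::finite) ext \<Rightarrow> ('a, 'n) ext" is fscale
  unfolding ext_rel_def by (metis free.scale_right_diff_distrib free.span_scale)

interpretation ext: vector_space ext_scale
  by unfold_locales
    (transfer; simp add: ext_rel_def free.span_zero free.scale_right_distrib
      free.scale_left_distrib)+

definition wedge :: "('a::field_prime_char, 'n::finite) witt list \<Rightarrow> ('a, 'n) ext" where
  "wedge us = abs_ext (Poly_Mapping.single us 1)"

definition ext_grade :: "nat \<Rightarrow> int \<Rightarrow> ('a::field_prime_char, 'n::finite) ext set" where
  "ext_grade m i = ext.span {wedge us | us. length us = m \<and>
     (\<exists>d. (\<forall>k<m. us ! k \<in> witt_grade (d k)) \<and> (\<Sum>k<m. d k) = i)}"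

definition ext_above :: "nat \<Rightarrow> int \<Rightarrow> ('a::field_prime_char, 'n::finite) ext set" where
  "ext_above m i = ext.span (\<Union>j\<in>{i<..}. ext_grade m j)"

text \<open>
  The variables are numbered \<open>x\<^sub>1, \<dots>, x\<^sub>n\<close> along the order of the index type, so the list below
  is \<open>\<partial>\<^sub>1, \<dots>, \<partial>\<^sub>n\<close>.
\<close>

definition partials :: "('a::field_prime_char, 'n::{finite,linorder}) witt list" where
  "partials = map partial (sorted_list_of_set UNIV)"

definition lowest_coeff :: "('a::field_prime_char, 'n::{finite,linorder}) witt list \<Rightarrow> 'a" where
  "lowest_coeff us =
    (THE c. wedge us - ext_scale c (wedge partials) \<in> ext_above CARD('n) (- int CARD('n)))"

definition Delta0 :: "('a::field_prime_char, 'n::{finite,linorder}) witt \<Rightarrow> 'a" where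
  "Delta0 D = lowest_coeff (map (\<lambda>k. ppow k D) [0..<CARD('n)])"

text \<open>The factors are numbered from \<open>1\<close>, list positions from \<open>0\<close>.\<close>

definition Delta_repl :: "nat \<Rightarrow> ('a::field_prime_char, 'n::{finite,linorder}) witt \<Rightarrow> 'a" where
  "Delta_repl i D =
    lowest_coeff ((map (\<lambda>k. ppow k D) [0..<CARD('n)])[i - 1 := ppow CARD('n) D])"

definition Delta :: "('a::field_prime_char, 'n::finite) witt \<Rightarrow> 'a" where
  "Delta D = eval0 ((der_apply D ^^ (CHAR('a) ^ CARD('n) - 1)) (tmonom (\<lambda>_. CHAR('a) - 1)))"

text \<open>
  \<open>psi i D\<close> is the coefficient of \<open>t\<^bsup>p^i\<^esup>\<close> in \<open>det (t I - D)\<close>; by a theorem of Premet,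
  all other coefficients vanish except the leading one, \<open>t\<^bsup>p^n\<^esup>\<close>.
\<close>

definition psi :: "nat \<Rightarrow> ('a::field_prime_char, 'n::finite) witt \<Rightarrow> 'a" where
  "psi i D = poly.coeff (endo_char_poly (der_apply D)) (CHAR('a) ^ i)"

text \<open>
  These are polynomial functions on the space \<open>('a, 'n) witt\<close>.  Over an infinite field the polynomial
  functions form an integral domain under pointwise operations, so an identity \<open>f = g / h\<close> in its
  field of fractions means that \<open>h\<close> is not identically zero and \<open>f D * h D = g D\<close> for all \<open>D\<close>.
\<close>

end

theory Submission
  imports Defs "HOL-Analysis.Determinants" "HOL-Number_Theory.Residues"
begin

text \<open>
  Write \<open>N = p\<^sup>n\<close>.  The coefficient \<open>\<Delta>\<^sub>0 D\<close> is the determinant of the constant parts of the vector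
  fields \<open>D, D\<^sup>p, \<dots>\<close>.  When it is nonzero, take linear coordinates \<open>z\<close> dual to these constant parts.
  Expanding \<open>m < N\<close> in base \<open>p\<close> makes \<open>D\<^sup>m\<close> a product of the commuting derivations \<open>D\<^bsup>p^k\<^esup>\<close>, and
  then the functionals \<open>f \<mapsto> (D\<^sup>m f)(0)\<close> are triangular with respect to the monomials in \<open>z\<close>; hence
  they are linearly independent.  A combination \<open>E = D\<^bsup>p^n\<^esup> - \<Sum> c\<^sub>i D\<^bsup>p^i\<^esup>\<close> has vanishing constant
  part, so \<open>(E f)(0) = 0\<close> for all \<open>f\<close>; comparing with the Cayley-Hamilton relation among the same
  functionals identifies \<open>\<psi>\<^sub>i = - c\<^sub>i\<close>, and Cramer's rule gives \<open>\<Delta>\<^sub>i\<close>.  The formula for \<open>\<Delta>\<close> comes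
  from the top monomial, on which a linear substitution acts by the \<open>(p - 1)\<close>-st power of its
  determinant.  The locus \<open>\<Delta>\<^sub>0 \<noteq> 0\<close> is nonempty by a Vandermonde determinant, hence dense.
\<close>

text \<open>The value (D f)(0) depends only on the constant part of D, so linear relations among D,
  D^p, ..., D^(p^n) at the origin can be read off from vectors of length n. For a product of several
  derivations this fails: the higher terms of one factor are differentiated by the next. They count
  less, however, with respect to the powers of the maximal ideal, since a derivation lowers the
  order by at most one, and a derivation without constant part does not lower it at all. Hence D^m
  agrees with a product of constant fields to leading order only, and the matrix of values (D^m
  z^b)(0) is triangular for the digit sum instead of diagonal. Its diagonal entries are products of
  factorials of digits, nonzero because digits are smaller than p. Density is used along lines only:
  all functions involved become polynomials in s on the line D + s (E - D), and a nonzero polynomial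
  has finitely many roots in an infinite field.\<close>

no_notation Matrix.vec_index (infixl \<open>$\<close> 100)
hide_const (open) Determinant.det Matrix.row Matrix.mat up_ring.coeff up_ring.monom module.smult

section \<open>The truncated polynomial ring\<close>

lemma poly_mapping_eq_sum_single:
  fixes f :: "'k \<Rightarrow>\<^sub>0 'b::comm_monoid_add"
  shows "f = (\<Sum>k\<in>Poly_Mapping.keys f. Poly_Mapping.single k (Poly_Mapping.lookup f k))"
proof (rule poly_mapping_eqI)
  fix k
  show "Poly_Mapping.lookup f k = Poly_Mapping.lookup (\<Sum>k\<in>Poly_Mapping.keys f. Poly_Mapping.single k (Poly_Mapping.lookup f k)) k"
    by (simp add: lookup_sum lookup_single when_def in_keys_iff)
qed

lemma poly_mapping_induct_single [case_names single add]:
  fixes f :: "'k \<Rightarrow>\<^sub>0 'b::comm_monoid_add"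
  assumes "\<And>k c. P (Poly_Mapping.single k c)" "\<And>f g. P f \<Longrightarrow> P g \<Longrightarrow> P (f + g)"
  shows "P f"
proof -
  have "P (\<Sum>k\<in>K. Poly_Mapping.single k (Poly_Mapping.lookup f k))" if "finite K" for K
    using that
  proof (induction K rule: finite_induct)
    case empty
    show ?case using assms(1)[of undefined 0] by simp
  qed (simp add: assms)
  from this[of "Poly_Mapping.keys f"] show ?thesis
    using poly_mapping_eq_sum_single[of f] by simp
qed

lemma pvar_power: "pvar i ^ m = Poly_Mapping.single (Poly_Mapping.single i m) 1"
  by (induction m) (simp_all add: pvar_def mult_single single_add[symmetric])

lemma prod_single_one:
  assumes "finite A"
  shows "(\<Prod>i\<in>A. Poly_Mapping.single (k i) (1::'a::comm_ring_1)) = Poly_Mapping.single (\<Sum>i\<in>A. k i) 1"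
  using assms by (induction A rule: finite_induct) (simp_all add: mult_single)

lemma single_eq_pvar_prod:
  fixes k :: "'n::finite \<Rightarrow>\<^sub>0 nat" and c :: "'a::comm_ring_1"
  shows "Poly_Mapping.single k c = Poly_Mapping.single 0 c * (\<Prod>i\<in>UNIV. pvar i ^ Poly_Mapping.lookup k i)"
proof -
  have "(\<Sum>i\<in>UNIV. Poly_Mapping.single i (Poly_Mapping.lookup k i)) = k"
    by (rule poly_mapping_eqI) (simp add: lookup_sum lookup_single when_def)
  then show ?thesis
    by (simp add: pvar_power prod_single_one mult_single)
qed

lemma abs_trunc_add: "abs_trunc (f + g) = abs_trunc f + abs_trunc g"
  by (simp add: plus_trunc.abs_eq)
lemma abs_trunc_mult: "abs_trunc (f * g) = abs_trunc f * abs_trunc g"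
  by (simp add: times_trunc.abs_eq)
lemma abs_trunc_1: "abs_trunc 1 = 1"
  by (simp add: one_trunc_def)
lemma abs_trunc_power: "abs_trunc (f ^ m) = abs_trunc f ^ m"
  by (induction m) (simp_all add: abs_trunc_mult abs_trunc_1)
lemma abs_trunc_prod: "abs_trunc (\<Prod>i\<in>A. f i) = (\<Prod>i\<in>A. abs_trunc (f i))"
  by (induction A rule: infinite_finite_induct) (simp_all add: abs_trunc_mult abs_trunc_1)
lemma abs_trunc_pvar: "abs_trunc (pvar i) = tvar i"
  by (simp add: tvar_def)
lemma abs_trunc_const: "abs_trunc (Poly_Mapping.single 0 c) = tconst c"
  by (simp add: tconst_def)

lemma abs_trunc_single:
  "abs_trunc (Poly_Mapping.single k c) = tscale c (tmonom (Poly_Mapping.lookup k))"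
  by (subst single_eq_pvar_prod)
    (simp add: abs_trunc_mult abs_trunc_prod abs_trunc_power abs_trunc_pvar abs_trunc_const
      tmonom_def tscale_def)

text \<open>Every class has a polynomial representative, and polynomials are sums of scaled
  monomials; properties stable under linear combinations thus reduce to
  \<open>tmonom\<close>.\<close>

lemma trunc_induct [case_names monom add scale]:
  fixes f :: "('a::field_prime_char, 'n::finite) trunc"
  assumes "\<And>a. P (tmonom a)" "\<And>f g. P f \<Longrightarrow> P g \<Longrightarrow> P (f + g)" "\<And>c f. P f \<Longrightarrow> P (tscale c f)"
  shows "P f"
proof -
  have "P (abs_trunc g)" for g
    by (induction g rule: poly_mapping_induct_single)
      (simp_all add: abs_trunc_add abs_trunc_single assms)
  then show ?thesis
    by (metis Quotient_trunc Quotient_abs_rep)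
qed

lemma tvar_power_CHAR: "(tvar i :: ('a::field_prime_char, 'n::finite) trunc) ^ CHAR('a) = 0"
proof -
  have "(\<Sum>j\<in>UNIV. (if j = i then 1 else 0) * pvar j ^ CHAR('a)) =
      (pvar i ^ CHAR('a) :: ('n \<Rightarrow>\<^sub>0 nat) \<Rightarrow>\<^sub>0 'a)"
    by (simp add: mult_delta_left)
  then have "(pvar i ^ CHAR('a) :: ('n \<Rightarrow>\<^sub>0 nat) \<Rightarrow>\<^sub>0 'a) \<in> trunc_ideal"
    unfolding trunc_ideal_def by (intro range_eqI[of _ _ "\<lambda>j. if j = i then 1 else 0"]) simp
  then have "abs_trunc (pvar i ^ CHAR('a) :: ('n \<Rightarrow>\<^sub>0 nat) \<Rightarrow>\<^sub>0 'a) = 0"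
    unfolding zero_trunc_def by (simp add: trunc.abs_eq_iff trunc_rel_def)
  then show ?thesis
    by (simp add: abs_trunc_power abs_trunc_pvar)
qed

section \<open>The value at the origin\<close>

lemma lookup_0_trunc_ideal:
  fixes f :: "('n::finite \<Rightarrow>\<^sub>0 nat) \<Rightarrow>\<^sub>0 'a::field_prime_char"
  assumes "f \<in> trunc_ideal"
  shows "Poly_Mapping.lookup f 0 = 0"
proof -
  obtain g where g: "f = (\<Sum>i\<in>UNIV. g i * pvar i ^ CHAR('a))"
    using assms unfolding trunc_ideal_def by blast
  have "Poly_Mapping.single i CHAR('a) \<noteq> 0" for i :: 'n
    by (metis CHAR_pos less_numeral_extra(3) lookup_single_eq lookup_zero)
  then show ?thesis
    by (simp add: g lookup_sum lookup_times_at_0 pvar_power lookup_single when_def)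
qed

text \<open>An explicit form of \<open>eval0\<close>, which is given only by unique choice. It
  descends to the quotient because the generators X_i^p have no constant term.\<close>

lift_definition ev :: "('a::field_prime_char, 'n::finite) trunc \<Rightarrow> 'a" is
  "\<lambda>f. Poly_Mapping.lookup f 0"
proof -
  fix f g :: "('n \<Rightarrow>\<^sub>0 nat) \<Rightarrow>\<^sub>0 'a"
  assume "trunc_rel f g"
  then have "Poly_Mapping.lookup (f - g) 0 = 0"
    unfolding trunc_rel_def by (rule lookup_0_trunc_ideal)
  then show "Poly_Mapping.lookup f 0 = Poly_Mapping.lookup g 0"
    by (simp add: lookup_minus)
qed

lemma ev_add [simp]: "ev (f + g) = ev f + ev g"
  by transfer (simp add: lookup_add)
lemma ev_diff [simp]: "ev (f - g) = ev f - ev g"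
  by transfer (simp add: lookup_minus)
lemma ev_mult [simp]: "ev (f * g) = ev f * ev g"
  by transfer (simp add: lookup_times_at_0)
lemma ev_0 [simp]: "ev 0 = 0"
  by transfer simp
lemma ev_1 [simp]: "ev 1 = 1"
  by transfer simp
lemma ev_tconst [simp]: "ev (tconst c) = c"
  by transfer simp
lemma ev_tscale [simp]: "ev (tscale c f) = c * ev f"
  by (simp add: tscale_def)
lemma ev_tvar [simp]: "ev (tvar i) = 0"
proof transfer
  fix i :: 'n
  have "Poly_Mapping.single i (Suc 0) \<noteq> 0"
    by (metis lookup_single_eq lookup_zero nat.distinct(1))
  then show "Poly_Mapping.lookup (pvar i :: ('n \<Rightarrow>\<^sub>0 nat) \<Rightarrow>\<^sub>0 'a::field_prime_char) 0 = 0"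
    by (simp add: pvar_def lookup_single when_def)
qed
lemma ev_sum [simp]: "ev (\<Sum>i\<in>A. f i) = (\<Sum>i\<in>A. ev (f i))"
  by (induction A rule: infinite_finite_induct) simp_all
lemma ev_power [simp]: "ev (f ^ m) = ev f ^ m"
  by (induction m) simp_all
lemma ev_prod [simp]: "ev (\<Prod>i\<in>A. f i) = (\<Prod>i\<in>A. ev (f i))"
  by (induction A rule: infinite_finite_induct) simp_all
lemma ev_of_nat [simp]: "ev (of_nat m) = of_nat m"
  by (induction m) simp_all

lemma max_ideal_closed:
  shows max_ideal_0: "0 \<in> max_ideal"
    and max_ideal_add: "f \<in> max_ideal \<Longrightarrow> g \<in> max_ideal \<Longrightarrow> f + g \<in> max_ideal"
    and max_ideal_mult: "f \<in> max_ideal \<Longrightarrow> h * f \<in> max_ideal"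
    and max_ideal_tvar: "tvar i \<in> max_ideal"
proof -
  show "0 \<in> max_ideal"
    unfolding max_ideal_def by (rule range_eqI[of _ _ "\<lambda>_. 0"]) simp
  show "f + g \<in> max_ideal" if fg: "f \<in> max_ideal" "g \<in> max_ideal"
  proof -
    obtain a b where "f = (\<Sum>i\<in>UNIV. a i * tvar i)" "g = (\<Sum>i\<in>UNIV. b i * tvar i)"
      using fg unfolding max_ideal_def by blast
    then show ?thesis
      unfolding max_ideal_def
      by (intro range_eqI[of _ _ "\<lambda>i. a i + b i"]) (simp add: sum.distrib distrib_right)
  qed
  show "h * f \<in> max_ideal" if f: "f \<in> max_ideal"
  proof -
    obtain a where "f = (\<Sum>i\<in>UNIV. a i * tvar i)"
      using f unfolding max_ideal_def by blast
    then show ?thesis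
      unfolding max_ideal_def
      by (intro range_eqI[of _ _ "\<lambda>i. h * a i"]) (simp add: sum_distrib_left mult.assoc)
  qed
  show "tvar i \<in> max_ideal"
    unfolding max_ideal_def
    by (rule range_eqI[of _ _ "\<lambda>j. if j = i then 1 else 0"]) (simp add: mult_delta_left)
qed

lemma tmonom_minus_ev_in_max_ideal:
  "(tmonom a - tconst (ev (tmonom a)) :: ('a::field_prime_char, 'n::finite) trunc) \<in> max_ideal"
proof (cases "\<exists>i. a i \<noteq> 0")
  case True
  then obtain i m where i: "a i = Suc m" by (meson not0_implies_Suc)
  have "(tmonom a :: ('a, 'n) trunc) = (\<Prod>j\<in>UNIV - {i}. tvar j ^ a j) * tvar i ^ m * tvar i"
    unfolding tmonom_def by (subst prod.remove[of _ i]) (simp_all add: i mult_ac)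
  then show ?thesis
    by (simp add: tconst_0 max_ideal_mult max_ideal_tvar)
next
  case False
  then show ?thesis by (simp add: tmonom_def tconst_1 max_ideal_0)
qed

lemma minus_ev_in_max_ideal: "f - tconst (ev f) \<in> max_ideal"
proof (induction f rule: trunc_induct)
  case (add f g)
  then show ?case using max_ideal_add[OF add] by (simp add: tconst_add algebra_simps)
next
  case (scale c f)
  then show ?case using max_ideal_mult[OF scale, of "tconst c"]
    by (simp add: tscale_def tconst_mult algebra_simps)
qed (rule tmonom_minus_ev_in_max_ideal)

lemma max_ideal_iff: "f \<in> max_ideal \<longleftrightarrow> ev f = 0"
proof
  assume "f \<in> max_ideal"
  then show "ev f = 0" unfolding max_ideal_def by auto
next
  assume "ev f = 0"
  then show "f \<in> max_ideal" using minus_ev_in_max_ideal[of f] by (simp add: tconst_0)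
qed

lemma eval0_eq_ev: "eval0 f = ev f"
  unfolding eval0_def max_ideal_iff by (rule the_equality) simp_all

section \<open>Truncated monomials and the bound on the dimension\<close>

lemma tmonom_eq_0:
  assumes "CHAR('a) \<le> a i"
  shows "(tmonom a :: ('a::field_prime_char, 'n::finite) trunc) = 0"
proof -
  have "(tvar i :: ('a, 'n) trunc) ^ a i = 0"
    using assms by (metis tvar_power_CHAR le_add_diff_inverse mult_zero_left power_add)
  then show ?thesis
    unfolding tmonom_def by (intro prod_zero) auto
qed

text \<open>Spanning and the bound on the cardinality give dimension at most p^n. The reverse
  inequality comes from the coordinate monomials of a generic derivation in
  \<open>card_basis\<close>.\<close>

definition tmonoms :: "('a::field_prime_char, 'n::finite) trunc set" where
  "tmonoms = tmonom ` (UNIV \<rightarrow>\<^sub>E {..<CHAR('a)})"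

lemma finite_tmonoms: "finite tmonoms"
  unfolding tmonoms_def by (intro finite_imageI finite_PiE) simp_all

lemma card_tmonoms_le: "card (tmonoms :: ('a::field_prime_char, 'n::finite) trunc set) \<le> CHAR('a) ^ CARD('n)"
proof -
  have "card (tmonoms :: ('a, 'n) trunc set) \<le> card ((UNIV :: 'n set) \<rightarrow>\<^sub>E {..<CHAR('a)})"
    unfolding tmonoms_def by (intro card_image_le finite_PiE) simp_all
  then show ?thesis by (simp add: card_PiE)
qed

lemma span_tmonoms: "trunc.span tmonoms = (UNIV :: ('a::field_prime_char, 'n::finite) trunc set)"
proof -
  have "f \<in> trunc.span tmonoms" for f :: "('a, 'n) trunc"
  proof (induction f rule: trunc_induct)
    case (monom a)
    show ?case
    proof (cases "\<exists>i. CHAR('a) \<le> a i")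
      case True
      then show ?thesis using tmonom_eq_0[where ?'a = 'a and ?'n = 'n] by (auto simp: trunc.span_zero)
    next
      case False
      then have "a \<in> UNIV \<rightarrow>\<^sub>E {..<CHAR('a)}" by (auto simp: not_le)
      then show ?thesis unfolding tmonoms_def by (intro trunc.span_base imageI)
    qed
  qed (auto intro: trunc.span_add trunc.span_scale)
  then show ?thesis by auto
qed

lemma CHAR_trunc: "CHAR(('a::field_prime_char, 'n::finite) trunc) = CHAR('a)"
proof (rule CHAR_eqI)
  show "of_nat CHAR('a) = (0 :: ('a, 'n) trunc)" by (rule of_nat_CHAR_trunc)
  fix m assume "of_nat m = (0 :: ('a, 'n) trunc)"
  then have "ev (of_nat m :: ('a, 'n) trunc) = 0" by simp
  then show "CHAR('a) dvd m" by (simp add: of_nat_eq_0_iff_char_dvd)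
qed

lemma prime_CHAR: "prime CHAR('a::field_prime_char)"
  by (rule prime_CHAR_semidom) (simp add: CHAR_pos)

section \<open>Derivations\<close>

text \<open>The formal partial derivative in the variable \<open>j\<close>, given by its
  coefficients.\<close>

lift_definition dpoly :: "'n \<Rightarrow> (('n \<Rightarrow>\<^sub>0 nat) \<Rightarrow>\<^sub>0 'a::comm_ring_1) \<Rightarrow> ('n \<Rightarrow>\<^sub>0 nat) \<Rightarrow>\<^sub>0 'a" is
  "\<lambda>j f k. of_nat (Suc (Poly_Mapping.lookup k j)) * f (k + Poly_Mapping.single j 1)"
proof -
  fix j :: 'n and f :: "('n \<Rightarrow>\<^sub>0 nat) \<Rightarrow> 'a"
  assume fin: "finite {k. f k \<noteq> 0}"
  have "{k. of_nat (Suc (Poly_Mapping.lookup k j)) * f (k + Poly_Mapping.single j 1) \<noteq> 0}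
      \<subseteq> (\<lambda>k. k - Poly_Mapping.single j 1) ` {k. f k \<noteq> 0}"
    by (auto intro!: image_eqI[where x = "k + Poly_Mapping.single j 1" for k])
  then show "finite {k. of_nat (Suc (Poly_Mapping.lookup k j)) * f (k + Poly_Mapping.single j 1) \<noteq> 0}"
    by (rule finite_subset) (simp add: fin)
qed

lemma dpoly_add: "dpoly j (f + g) = dpoly j f + dpoly j g"
  by (rule poly_mapping_eqI) (simp add: dpoly.rep_eq lookup_add algebra_simps)

text \<open>Subtraction of exponents is truncated. When the variable \<open>j\<close> does not
  occur, the exponent on the right is therefore wrong, but its coefficient is zero.\<close>

lemma dpoly_single:
  "dpoly j (Poly_Mapping.single k c) =
    Poly_Mapping.single (k - Poly_Mapping.single j 1) (of_nat (Poly_Mapping.lookup k j) * c)"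
proof (cases "Poly_Mapping.lookup k j = 0")
  case True
  have "k \<noteq> l + Poly_Mapping.single j (Suc 0)" for l
    using True by (auto simp: lookup_add)
  then show ?thesis
    by (intro poly_mapping_eqI) (simp add: dpoly.rep_eq lookup_single True)
next
  case False
  have eq: "k = l + Poly_Mapping.single j (Suc 0) \<longleftrightarrow> k - Poly_Mapping.single j (Suc 0) = l" for l
  proof
    assume l: "k - Poly_Mapping.single j (Suc 0) = l"
    show "k = l + Poly_Mapping.single j (Suc 0)"
    proof (rule poly_mapping_eqI)
      fix x
      show "Poly_Mapping.lookup k x = Poly_Mapping.lookup (l + Poly_Mapping.single j (Suc 0)) x"
        using False
        by (cases "x = j") (auto simp: l[symmetric] lookup_add lookup_minus lookup_single when_def)
    qed
  qed simp
  show ?thesis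
  proof (rule poly_mapping_eqI)
    fix l
    show "Poly_Mapping.lookup (dpoly j (Poly_Mapping.single k c)) l = Poly_Mapping.lookup
          (Poly_Mapping.single (k - Poly_Mapping.single j 1) (of_nat (Poly_Mapping.lookup k j) * c)) l"
      using False
      by (auto simp: dpoly.rep_eq lookup_single eq when_def lookup_minus)
  qed
qed

lemma dpoly_mult: "dpoly j (f * g) = f * dpoly j g + dpoly j f * g"
proof (induction f rule: poly_mapping_induct_single)
  case (single k c)
  show ?case
  proof (induction g rule: poly_mapping_induct_single)
    case (single l d)
    have 1: "k + (l - Poly_Mapping.single j 1) = k + l - Poly_Mapping.single j 1"
      if "Poly_Mapping.lookup l j \<noteq> 0" for k l :: "'a \<Rightarrow>\<^sub>0 nat"
      using that
      by (auto simp: poly_mapping_eq_iff fun_eq_iff lookup_add lookup_minus lookup_single when_def)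
    \<comment> \<open>The identity of exponents in \<open>1\<close> can fail for exponent zero; here
      the coefficient vanishes in that case, so no proviso remains.\<close>
    have 2: "Poly_Mapping.single (k + (l - Poly_Mapping.single j 1)) (of_nat (Poly_Mapping.lookup l j) * c)
        = Poly_Mapping.single (k + l - Poly_Mapping.single j 1) (of_nat (Poly_Mapping.lookup l j) * c)"
      for k l :: "'a \<Rightarrow>\<^sub>0 nat" and c :: 'b
      using 1[of l k] by (cases "Poly_Mapping.lookup l j = 0") simp_all
    show ?case
      using 2[of k l "c * d"] 2[of l k "c * d"]
      by (simp add: dpoly_single mult_single lookup_add single_add[symmetric] algebra_simps)
  qed (simp add: dpoly_add algebra_simps)
qed (simp add: dpoly_add algebra_simps)

lemma dpoly_const: "dpoly j (Poly_Mapping.single 0 c) = 0"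
  by (simp add: dpoly_single)

lemma dpoly_power: "dpoly j (f ^ Suc m) = of_nat (Suc m) * f ^ m * dpoly j f"
  by (induction m) (simp_all add: dpoly_mult algebra_simps)

text \<open>The derivative of a p-th power carries the factor p = 0, so by the Leibniz rule only the
  cofactors \<open>g i\<close> are differentiated.\<close>

lemma dpoly_trunc_ideal:
  fixes f :: "('n::finite \<Rightarrow>\<^sub>0 nat) \<Rightarrow>\<^sub>0 'a::field_prime_char"
  assumes "f \<in> trunc_ideal"
  shows "dpoly j f \<in> trunc_ideal"
proof -
  obtain g where g: "f = (\<Sum>i\<in>UNIV. g i * pvar i ^ CHAR('a))"
    using assms unfolding trunc_ideal_def by blast
  have sum: "dpoly j (\<Sum>i\<in>A. h i) = (\<Sum>i\<in>A. dpoly j (h i))" if "finite A"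
    for A :: "'n set" and h :: "'n \<Rightarrow> ('n \<Rightarrow>\<^sub>0 nat) \<Rightarrow>\<^sub>0 'a"
    using that
  proof (induction A rule: finite_induct)
    case empty
    then show ?case using dpoly_const[of j 0] by simp
  qed (simp add: dpoly_add)
  obtain m where m: "CHAR('a) = Suc m"
    using CHAR_pos[where ?'a = 'a] gr0_implies_Suc by blast
  have "(of_nat CHAR('a) :: ('n \<Rightarrow>\<^sub>0 nat) \<Rightarrow>\<^sub>0 'a) = 0"
    by (metis of_nat_CHAR single_of_nat single_zero)
  then have pow: "dpoly j (h ^ CHAR('a)) = 0" for h :: "('n \<Rightarrow>\<^sub>0 nat) \<Rightarrow>\<^sub>0 'a"
    unfolding m dpoly_power by (simp only: mult_zero_left)
  have "dpoly j f = (\<Sum>i\<in>UNIV. dpoly j (g i) * pvar i ^ CHAR('a))"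
    by (simp add: g sum dpoly_mult pow)
  then show ?thesis
    unfolding trunc_ideal_def by (intro range_eqI[of _ _ "\<lambda>i. dpoly j (g i)"]) simp
qed

lift_definition dtrunc :: "'n::finite \<Rightarrow> ('a::field_prime_char, 'n) trunc \<Rightarrow> ('a, 'n) trunc" is dpoly
proof -
  fix j :: 'n and f g :: "('n \<Rightarrow>\<^sub>0 nat) \<Rightarrow>\<^sub>0 'a"
  assume "trunc_rel f g"
  then have "dpoly j (f - g) \<in> trunc_ideal"
    unfolding trunc_rel_def by (rule dpoly_trunc_ideal)
  moreover have "dpoly j (f - g) = dpoly j f - dpoly j g"
    by (rule poly_mapping_eqI) (simp add: dpoly.rep_eq lookup_minus algebra_simps)
  ultimately show "trunc_rel (dpoly j f) (dpoly j g)"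
    by (simp add: trunc_rel_def)
qed

lemma trunc_rel_refl: "trunc_rel f f"
  by (simp add: trunc_rel_def trunc_ideal_0)

lemma is_derivation_dtrunc: "is_derivation (dtrunc j)"
proof -
  have "dtrunc j (f + g) = dtrunc j f + dtrunc j g" for f g :: "('a, 'b) trunc"
    by transfer (simp add: dpoly_add trunc_rel_refl)
  moreover have mult: "dtrunc j (f * g) = f * dtrunc j g + dtrunc j f * g" for f g :: "('a, 'b) trunc"
    by transfer (simp add: dpoly_mult trunc_rel_refl)
  moreover have "dtrunc j (tconst c :: ('a, 'b) trunc) = 0" for c
    by transfer (simp add: dpoly_const trunc_rel_refl)
  then have "dtrunc j (tscale c f) = tscale c (dtrunc j f)" for c and f :: "('a, 'b) trunc"
    by (simp add: tscale_def mult)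
  ultimately show ?thesis by (simp add: is_derivation_iff)
qed

lemma dtrunc_tvar: "dtrunc j (tvar i) = (if i = j then 1 else 0)"
proof transfer
  fix i j :: "'n::finite"
  show "trunc_rel (dpoly j (pvar i :: ('n \<Rightarrow>\<^sub>0 nat) \<Rightarrow>\<^sub>0 'a::field_prime_char)) (if i = j then 1 else 0)"
    by (auto simp: pvar_def dpoly_single lookup_single when_def trunc_rel_refl)
qed

lemma der_apply_add [simp]: "der_apply D (f + g) = der_apply D f + der_apply D g"
  and der_apply_tscale [simp]: "der_apply D (tscale c f) = tscale c (der_apply D f)"
  and der_apply_mult: "der_apply D (f * g) = f * der_apply D g + der_apply D f * g"
  using der_apply[of D] by (simp_all add: is_derivation_iff)

lemma der_apply_0 [simp]: "der_apply D 0 = 0"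
  using der_apply_add[of D 0 0] by simp
lemma der_apply_1 [simp]: "der_apply D 1 = 0"
  using der_apply_mult[of D 1 1] by simp
lemma der_apply_uminus [simp]: "der_apply D (- f) = - der_apply D f"
  using der_apply_add[of D f "- f"] by (simp add: eq_neg_iff_add_eq_0 add.commute)
lemma der_apply_diff [simp]: "der_apply D (f - g) = der_apply D f - der_apply D g"
  using der_apply_add[of D f "- g"] by simp
lemma der_apply_sum [simp]: "der_apply D (\<Sum>i\<in>A. f i) = (\<Sum>i\<in>A. der_apply D (f i))"
  by (induction A rule: infinite_finite_induct) simp_all
lemma der_apply_tconst [simp]: "der_apply D (tconst c) = 0"
  using der_apply_tscale[of D c 1] by (simp add: tscale_def)

lemma der_apply_tconst_mult [simp]: "der_apply D (tconst c * f) = tconst c * der_apply D f"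
  by (simp add: der_apply_mult)

lemma der_apply_power_eq_0: "der_apply D f = 0 \<Longrightarrow> der_apply D (f ^ m) = 0"
  by (induction m) (simp_all add: der_apply_mult)
lemma der_apply_prod_eq_0:
  "(\<And>i. i \<in> A \<Longrightarrow> der_apply D (f i) = 0) \<Longrightarrow> der_apply D (\<Prod>i\<in>A. f i) = 0"
  by (induction A rule: infinite_finite_induct) (simp_all add: der_apply_mult)

lemma witt_eqI:
  fixes D E :: "('a::field_prime_char, 'n::finite) witt"
  assumes "\<And>i. der_apply D (tvar i) = der_apply E (tvar i)"
  shows "D = E"
proof -
  have pow: "der_apply D (tvar i ^ m) = der_apply E (tvar i ^ m)" for i m
    by (induction m) (simp_all add: der_apply_mult assms)
  have prod: "der_apply D (\<Prod>i\<in>A. tvar i ^ a i) = der_apply E (\<Prod>i\<in>A. tvar i ^ a i)"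
    if "finite A" for a and A :: "'n set"
    using that by (induction A rule: finite_induct) (simp_all add: der_apply_mult pow)
  have "der_apply D f = der_apply E f" for f
    by (induction f rule: trunc_induct) (simp_all add: tmonom_def prod)
  then show ?thesis by (metis der_apply_inject ext)
qed

text \<open>Discharges the definite description in \<open>partial\<close>: \<open>dtrunc\<close>
  provides existence, \<open>witt_eqI\<close> uniqueness.\<close>

lemma der_apply_partial: "der_apply (partial j) (tvar i) = (if i = j then 1 else 0)"
proof -
  have "\<exists>!D :: ('a::field_prime_char, 'n::finite) witt. \<forall>i. der_apply D (tvar i) = (if i = j then 1 else 0)" for j
    by (rule ex1I[of _ "Abs_witt (dtrunc j)"])
      (auto intro: witt_eqI simp: Abs_witt_inverse is_derivation_dtrunc dtrunc_tvar)
  from theI'[OF this] show ?thesis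
    unfolding partial_def by blast
qed

lemma der_apply_plus [simp]: "der_apply (D + E) f = der_apply D f + der_apply E f"
  by transfer simp
lemma der_apply_minus [simp]: "der_apply (D - E) f = der_apply D f - der_apply E f"
  by transfer simp
lemma der_apply_zero [simp]: "der_apply 0 f = 0"
  by transfer simp
lemma der_apply_wscale [simp]: "der_apply (wscale c D) f = tscale c (der_apply D f)"
  by transfer simp
lemma der_apply_witt_sum [simp]: "der_apply (\<Sum>i\<in>A. D i) f = (\<Sum>i\<in>A. der_apply (D i) f)"
  by (induction A rule: infinite_finite_induct) simp_all
lemma der_apply_ppow: "der_apply (ppow k D :: ('a::field_prime_char, 'n::finite) witt) = der_apply D ^^ (CHAR('a) ^ k)"
  by transfer simp

lemma witt_eq_sum_partial: "D = (\<Sum>j\<in>UNIV. wmult (der_apply D (tvar j)) (partial j))"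
  by (rule witt_eqI) (simp add: der_apply_partial if_distrib cong: if_cong)

section \<open>The lowest coefficient of a wedge product\<close>

text \<open>Matrices are indexed by the type \<open>'n\<close>, wedge factors by list positions;
  \<open>nth_var\<close> and \<open>var_index\<close> translate between the two.\<close>

definition nth_var :: "nat \<Rightarrow> 'n::{finite,linorder}" where
  "nth_var k = sorted_list_of_set UNIV ! k"

definition var_index :: "'n::{finite,linorder} \<Rightarrow> nat" where
  "var_index = inv_into {..<CARD('n)} nth_var"

lemma bij_nth_var: "bij_betw (nth_var :: nat \<Rightarrow> 'n::{finite,linorder}) {..<CARD('n)} UNIV"
proof -
  have "bij_betw ((!) (sorted_list_of_set (UNIV :: 'n set))) {..<CARD('n)} UNIV"
    by (rule bij_betw_nth) simp_all
  then show ?thesis by (simp add: nth_var_def[abs_def])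
qed

lemma bij_var_index: "bij_betw (var_index :: 'n::{finite,linorder} \<Rightarrow> nat) UNIV {..<CARD('n)}"
  unfolding var_index_def by (rule bij_betw_inv_into[OF bij_nth_var])

lemma var_index_less [simp]: "var_index (i :: 'n::{finite,linorder}) < CARD('n)"
  using bij_betwE[OF bij_var_index] by blast

lemma nth_var_index [simp]: "nth_var (var_index i) = i"
  unfolding var_index_def
  by (rule f_inv_into_f) (use bij_nth_var[where ?'n = 'a] in \<open>auto simp: bij_betw_def\<close>)

lemma index_nth_var [simp]: "k < CARD('n) \<Longrightarrow> var_index (nth_var k :: 'n::{finite,linorder}) = k"
  unfolding var_index_def
  by (rule inv_into_f_f) (use bij_nth_var[where ?'n = 'n] in \<open>auto simp: bij_betw_def\<close>)

lemma var_index_inj [simp]: "var_index i = var_index j \<longleftrightarrow> i = j"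
  by (metis nth_var_index)

section \<open>The determinant of constant parts as a form on the exterior algebra\<close>

definition const_part :: "('a::field_prime_char, 'n::finite) witt \<Rightarrow> 'a ^ 'n" where
  "const_part D = (\<chi> j. ev (der_apply D (tvar j)))"

lemma const_part_add: "const_part (D + E) = const_part D + const_part E"
  and const_part_wscale: "const_part (wscale c D) = c *s const_part D"
  by (simp_all add: const_part_def vec_eq_iff)

type_synonym ('a, 'n) sqmat =
  "(('a, 'n) Finite_Cartesian_Product.vec, 'n) Finite_Cartesian_Product.vec"

text \<open>The value 0 on lists of any other length keeps the form multilinear and alternating on
  all lists, so that it factors through \<open>ext\<close>, where lists of all lengths occur
  together.\<close>

definition const_det :: "('a::field_prime_char, 'n::{finite,linorder}) witt list \<Rightarrow> 'a" where
  "const_det us = (if length us = CARD('n)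
     then det (\<chi> i. const_part (us ! var_index i) :: ('a, 'n) sqmat) else 0)"

lemma const_det_linear:
  "const_det (us @ (wscale a x + wscale b y) # vs) =
    a * const_det (us @ x # vs) + b * const_det (us @ y # vs)"
  for x y :: "('a::field_prime_char, 'n::{finite,linorder}) witt"
proof (cases "Suc (length us + length vs) = CARD('n)")
  case True
  define k :: 'n where "k = nth_var (length us)"
  have k: "var_index i = length us \<longleftrightarrow> i = k" for i :: 'n
    unfolding k_def using True by (metis index_nth_var less_add_Suc1 nth_var_index)
  define c where "c = (\<lambda>i. const_part ((us @ x # vs) ! var_index (i :: 'n)))"
  have nth: "(us @ u # vs) ! m = (us @ x # vs) ! m" if "m \<noteq> length us" for u m
    using that by (cases "m < length us") (simp_all add: nth_append nth_Cons')
  have row: "(\<chi> i. const_part ((us @ u # vs) ! var_index i)) =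
      (\<chi> i. if i = k then const_part u else c i)" for u :: "('a, 'n) witt"
  proof -
    have "const_part ((us @ u # vs) ! var_index i) = (if i = k then const_part u else c i)" for i
    proof (cases "i = k")
      case True
      then have "var_index i = length us" by (simp add: k)
      then show ?thesis by (simp add: True)
    next
      case False
      then show ?thesis using nth[of "var_index i" u] by (simp add: k c_def)
    qed
    then show ?thesis by simp
  qed
  show ?thesis
    unfolding const_det_def row using True
    det_row_add[of k "\<lambda>_. a *s const_part x" "\<lambda>_. b *s const_part y" c]
      det_row_mul[of k a "\<lambda>_. const_part x" c] det_row_mul[of k b "\<lambda>_. const_part y" c]
    by (simp add: const_part_add const_part_wscale cong: if_cong)
qed (simp add: const_det_def)

lemma const_det_not_distinct:
  assumes "\<not> distinct us"
  shows "const_det (us :: ('a::field_prime_char, 'n::{finite,linorder}) witt list) = 0"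
proof (cases "length us = CARD('n)")
  case True
  obtain k l where kl: "k < CARD('n)" "l < CARD('n)" "k \<noteq> l" "us ! k = us ! l"
    using assms True by (auto simp: distinct_conv_nth)
  have "det (\<chi> i. const_part (us ! var_index i) :: ('a, 'n) sqmat) = 0"
  proof (rule det_identical_rows)
    show "nth_var k \<noteq> (nth_var l :: 'n)" using kl by (metis index_nth_var)
    show "row (nth_var k) (\<chi> i. const_part (us ! var_index i) :: ('a, 'n) sqmat)
        = row (nth_var l) (\<chi> i. const_part (us ! var_index i) :: ('a, 'n) sqmat)"
      using kl by (simp add: row_def)
  qed
  then show ?thesis by (simp add: const_det_def)
qed (simp add: const_det_def)

definition free_det ::
    "(('a::field_prime_char, 'n::{finite,linorder}) witt list \<Rightarrow>\<^sub>0 'a) \<Rightarrow> 'a" where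
  "free_det f = (\<Sum>us\<in>Poly_Mapping.keys f. Poly_Mapping.lookup f us * const_det us)"

lemma free_det_superset:
  assumes "finite S" "Poly_Mapping.keys f \<subseteq> S"
  shows "free_det f = (\<Sum>us\<in>S. Poly_Mapping.lookup f us * const_det us)"
  unfolding free_det_def using assms by (intro sum.mono_neutral_left) (auto simp: in_keys_iff)

lemma free_det_linear:
  shows free_det_add: "free_det (f + g) = free_det f + free_det g"
    and free_det_diff: "free_det (f - g) = free_det f - free_det g"
    and free_det_scale: "free_det (fscale c f) = c * free_det f"
    and free_det_single: "free_det (Poly_Mapping.single us c) = c * const_det us"
proof -
  let ?S = "Poly_Mapping.keys f \<union> Poly_Mapping.keys g"
  have "Poly_Mapping.keys (f + g) \<subseteq> ?S" "Poly_Mapping.keys (f - g) \<subseteq> ?S"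
    "Poly_Mapping.keys (fscale c f) \<subseteq> ?S"
    by (auto simp: in_keys_iff lookup_add lookup_minus)
  then show "free_det (f + g) = free_det f + free_det g" "free_det (f - g) = free_det f - free_det g"
    "free_det (fscale c f) = c * free_det f"
    using free_det_superset[of ?S f] free_det_superset[of ?S g] free_det_superset[of ?S "f + g"]
      free_det_superset[of ?S "f - g"] free_det_superset[of ?S "fscale c f"]
    by (simp_all add: lookup_add lookup_minus algebra_simps sum.distrib sum_subtractf
        sum_distrib_left)
  show "free_det (Poly_Mapping.single us c) = c * const_det us"
    by (simp add: free_det_def)
qed

text \<open>The two families of generators of the relations express precisely that a determinant is
  linear in each row and vanishes when two rows coincide.\<close>

lemma free_det_relations:
  assumes "f \<in> free.span ext_relations"
  shows "free_det f = 0"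
  using assms
proof (rule free.span_induct)
  show "free.subspace {f. free_det f = 0}"
    unfolding free.subspace_def by (simp add: free_det_add free_det_scale) (simp add: free_det_def)
qed (auto simp: ext_relations_def free_det_diff free_det_scale free_det_single const_det_linear
    const_det_not_distinct)

lift_definition ext_det :: "('a::field_prime_char, 'n::{finite,linorder}) ext \<Rightarrow> 'a" is free_det
  unfolding ext_rel_def using free_det_relations by (force simp: free_det_diff)

lemma ext_det_add: "ext_det (u + v) = ext_det u + ext_det v"
  by transfer (rule free_det_add)
lemma ext_det_diff: "ext_det (u - v) = ext_det u - ext_det v"
  by transfer (rule free_det_diff)
lemma ext_det_scale: "ext_det (ext_scale c u) = c * ext_det u"
  by transfer (rule free_det_scale)
lemma ext_det_0: "ext_det 0 = 0"
  using ext_det_scale[of 0 0] by simp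
lemma ext_det_wedge: "ext_det (wedge us) = const_det us"
  by (simp add: wedge_def ext_det.abs_eq free_det_single)

lemma ev_tmonom: "a i \<noteq> 0 \<Longrightarrow> ev (tmonom a) = 0"
  by (auto simp: tmonom_def power_0_left)

text \<open>A monomial field of degree d has a coefficient of total degree d + 1, which is positive
  here, hence vanishes at the origin.\<close>

lemma const_part_grade:
  assumes "D \<in> witt_grade d" "d \<ge> 0"
  shows "const_part (D :: ('a::field_prime_char, 'n::finite) witt) = 0"
  using assms(1) unfolding witt_grade_def
proof (rule witt.span_induct)
  show "witt.subspace {D :: ('a, 'n) witt. const_part D = 0}"
    unfolding witt.subspace_def
    by (simp add: const_part_add const_part_wscale) (simp add: const_part_def vec_eq_iff)
  fix D :: "('a, 'n) witt"
  assume "D \<in> {wmult (tmonom a) (partial j) | a j.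
     (\<forall>k. a k \<le> CHAR('a) - 1) \<and> (\<Sum>k\<in>UNIV. int (a k)) - 1 = d}"
  then obtain a j where D: "D = wmult (tmonom a) (partial j)" and d: "(\<Sum>k\<in>UNIV. int (a k)) - 1 = d"
    by blast
  have "\<exists>k. a k \<noteq> 0" using d assms(2) by (rule_tac ccontr) simp
  then show "const_part D = 0" by (auto simp: D const_part_def vec_eq_iff ev_tmonom)
qed

text \<open>If n degrees sum to more than -n, one of them is at least 0, and the corresponding row
  of constant parts is zero. This gives the uniqueness half of \<open>lowest_coeff\<close>.\<close>

lemma ext_det_above:
  assumes "u \<in> ext_above CARD('n) (- int CARD('n))"
  shows "ext_det (u :: ('a::field_prime_char, 'n::{finite,linorder}) ext) = 0"
proof -
  have sub: "ext.subspace {u :: ('a, 'n) ext. ext_det u = 0}"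
    unfolding ext.subspace_def by (simp add: ext_det_add ext_det_scale ext_det_0)
  show ?thesis
    using assms unfolding ext_above_def
  proof (rule ext.span_induct[OF _ sub])
    fix u :: "('a, 'n) ext"
    assume "u \<in> (\<Union>j\<in>{- int CARD('n)<..}. ext_grade CARD('n) j)"
    then obtain j where j: "j > - int CARD('n)" "u \<in> ext_grade CARD('n) j" by auto
    show "ext_det u = 0"
      using j(2) unfolding ext_grade_def
    proof (rule ext.span_induct[OF _ sub])
      fix u :: "('a, 'n) ext"
      assume "u \<in> {wedge us |us. length us = CARD('n) \<and>
        (\<exists>d. (\<forall>k<CARD('n). us ! k \<in> witt_grade (d k)) \<and> (\<Sum>k<CARD('n). d k) = j)}"
      then obtain us d where us: "u = wedge us" "length us = CARD('n)"
        "\<And>k. k < CARD('n) \<Longrightarrow> us ! k \<in> witt_grade (d k)" and d: "(\<Sum>k<CARD('n). d k) = j"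
        by blast
      have "\<exists>k<CARD('n). d k \<ge> 0"
      proof (rule ccontr)
        assume "\<not> ?thesis"
        then have "(\<Sum>k<CARD('n). d k) \<le> (\<Sum>k<CARD('n). -1)" by (intro sum_mono) force
        then show False using j(1) d by simp
      qed
      then obtain k where k: "k < CARD('n)" "d k \<ge> 0" by blast
      have "det (\<chi> i. const_part (us ! var_index i) :: ('a, 'n) sqmat) = 0"
        by (rule det_zero_row(2)[of "nth_var k"])
          (use k const_part_grade[OF us(3) k(2)] in \<open>simp add: row_def vec_eq_iff\<close>)
      then show "ext_det u = 0" by (simp add: us(1) ext_det_wedge const_det_def)
    qed
  qed
qed

section \<open>Calculus of wedge products\<close>

lemma wedge_linear:
  "wedge (us @ (wscale a x + wscale b y) # vs) =
    ext_scale a (wedge (us @ x # vs)) + ext_scale b (wedge (us @ y # vs))"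
proof -
  have "Poly_Mapping.single (us @ (wscale a x + wscale b y) # vs) 1
       - fscale a (Poly_Mapping.single (us @ x # vs) 1)
       - fscale b (Poly_Mapping.single (us @ y # vs) 1) \<in> free.span ext_relations"
    unfolding ext_relations_def by (intro free.span_base UnI1 CollectI exI conjI TrueI) (rule refl)
  then have "abs_ext (Poly_Mapping.single (us @ (wscale a x + wscale b y) # vs) 1) =
      abs_ext (fscale a (Poly_Mapping.single (us @ x # vs) 1) + fscale b (Poly_Mapping.single (us @ y # vs) 1))"
    by (simp add: ext.abs_eq_iff ext_rel_def algebra_simps)
  then show ?thesis
    by (simp add: wedge_def plus_ext.abs_eq ext_scale.abs_eq)
qed

lemma wedge_not_distinct: "\<not> distinct us \<Longrightarrow> wedge us = 0"
  unfolding wedge_def zero_ext_def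
  by (auto simp: ext.abs_eq_iff ext_rel_def ext_relations_def intro!: free.span_base)

lemma wedge_add: "wedge (us @ (x + y) # vs) = wedge (us @ x # vs) + wedge (us @ y # vs)"
  using wedge_linear[of us 1 x 1 y vs] by simp

lemma wedge_scale: "wedge (us @ wscale a x # vs) = ext_scale a (wedge (us @ x # vs))"
  using wedge_linear[of us a x 0 x vs] by simp

lemma wedge_zero: "wedge (us @ 0 # vs) = 0"
  using wedge_scale[of us 0 0 vs] by simp

lemma wedge_swap: "wedge (us @ x # y # vs) = - wedge (us @ y # x # vs)"
proof -
  have "0 = wedge (us @ (x + y) # (x + y) # vs)"
    by (simp add: wedge_not_distinct)
  also have "\<dots> = wedge (us @ x # (x + y) # vs) + wedge (us @ y # (x + y) # vs)"
    by (rule wedge_add)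
  also have "\<dots> = wedge (us @ x # x # vs) + wedge (us @ x # y # vs)
      + (wedge (us @ y # x # vs) + wedge (us @ y # y # vs))"
    using wedge_add[of "us @ [x]" x y vs] wedge_add[of "us @ [y]" x y vs] by simp
  also have "\<dots> = wedge (us @ x # y # vs) + wedge (us @ y # x # vs)"
    by (simp add: wedge_not_distinct)
  finally show ?thesis by (simp add: eq_neg_iff_add_eq_0)
qed

lemma ext_span_singleton_trans:
  "u \<in> ext.span {v} \<Longrightarrow> v \<in> ext.span {w} \<Longrightarrow> u \<in> ext.span {w}"
  using ext.span_minimal[of "{v}" "ext.span {w}"] by auto

text \<open>Transpositions only change the sign. Working with the spanned line avoids tracking it;
  the scalar is determined later by \<open>ext_det\<close>.\<close>

lemma wedge_move_to_front: "wedge (us @ vs @ x # ws) \<in> ext.span {wedge (us @ x # vs @ ws)}"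
proof (induction vs arbitrary: us)
  case Nil
  show ?case by (simp add: ext.span_base)
next
  case (Cons v vs)
  have "wedge (us @ v # x # vs @ ws) \<in> ext.span {wedge (us @ x # v # vs @ ws)}"
    by (subst wedge_swap) (intro ext.span_neg ext.span_base, simp)
  then show ?case
    using Cons.IH[of "us @ [v]"] by (auto intro: ext_span_singleton_trans)
qed

lemma wedge_permute: "mset us = mset vs \<Longrightarrow> wedge (ws @ us) \<in> ext.span {wedge (ws @ vs)}"
proof (induction vs arbitrary: us ws)
  case Nil
  then show ?case by (simp add: ext.span_base)
next
  case (Cons v vs)
  then have "v \<in> set us" by (metis list.set_intros(1) set_mset_mset)
  then obtain us1 us2 where us: "us = us1 @ v # us2" by (meson split_list)
  have "wedge ((ws @ [v]) @ us1 @ us2) \<in> ext.span {wedge ((ws @ [v]) @ vs)}"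
    using Cons.prems by (intro Cons.IH) (simp add: us)
  moreover have "wedge (ws @ us) \<in> ext.span {wedge (ws @ v # us1 @ us2)}"
    unfolding us by (rule wedge_move_to_front)
  ultimately show ?case
    by (auto intro: ext_span_singleton_trans)
qed

text \<open>Multilinearity, one factor at a time. The prefix \<open>ws\<close> is arbitrary so that
  the induction can move factors already expanded into it.\<close>

lemma wedge_expand:
  assumes "witt.span B = UNIV"
  shows "wedge (ws @ us) \<in> ext.span {wedge (ws @ vs) | vs. set vs \<subseteq> B \<and> length vs = length us}"
proof (induction us arbitrary: ws)
  case Nil
  show ?case by (simp add: ext.span_base)
next
  case (Cons u us)
  let ?S = "{wedge (ws @ vs) | vs. set vs \<subseteq> B \<and> length vs = Suc (length us)}"
  have "u \<in> witt.span B" using assms by simp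
  then have "wedge (ws @ u # us) \<in> ext.span ?S"
  proof (rule witt.span_induct)
    show "witt.subspace {u. wedge (ws @ u # us) \<in> ext.span ?S}"
      unfolding witt.subspace_def
      by (auto simp: wedge_zero wedge_add wedge_scale ext.span_zero intro: ext.span_add ext.span_scale)
    fix v assume v: "v \<in> B"
    have "{wedge ((ws @ [v]) @ vs) | vs. set vs \<subseteq> B \<and> length vs = length us} \<subseteq> ?S"
    proof safe
      fix vs assume "set vs \<subseteq> B" "length vs = length us"
      then show "\<exists>vs'. wedge ((ws @ [v]) @ vs) = wedge (ws @ vs') \<and> set vs' \<subseteq> B \<and> length vs' = Suc (length us)"
        using v by (intro exI[of _ "v # vs"]) simp
    qed
    from ext.span_mono[OF this] Cons.IH[of "ws @ [v]"] show "wedge (ws @ v # us) \<in> ext.span ?S"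
      by auto
  qed
  then show ?case by simp
qed

section \<open>Wedge products modulo higher degree\<close>

definition witt_monoms :: "('a::field_prime_char, 'n::finite) witt set" where
  "witt_monoms = {wmult (tmonom a) (partial j) | a j. \<forall>k. a k \<le> CHAR('a) - 1}"

lemma span_witt_monoms: "witt.span witt_monoms = (UNIV :: ('a::field_prime_char, 'n::finite) witt set)"
proof -
  have "wmult f (partial j) \<in> witt.span witt_monoms" for f :: "('a, 'n) trunc" and j
  proof -
    have "f \<in> trunc.span tmonoms" by (simp add: span_tmonoms)
    then show ?thesis
    proof (rule trunc.span_induct)
      have "wmult 0 (partial j) = (0 :: ('a, 'n) witt)"
        "wmult (g + h) (partial j) = wmult g (partial j) + (wmult h (partial j) :: ('a, 'n) witt)"
        "wmult (tscale c g) (partial j) = wscale c (wmult g (partial j))" for g h :: "('a, 'n) trunc" and c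
        by (auto intro!: witt_eqI simp: algebra_simps tscale_def)
      then show "trunc.subspace {f :: ('a, 'n) trunc. wmult f (partial j) \<in> witt.span witt_monoms}"
        unfolding trunc.subspace_def
        by (auto simp: witt.span_zero intro: witt.span_add witt.span_scale)
      fix g :: "('a, 'n) trunc" assume "g \<in> tmonoms"
      then obtain a where a: "g = tmonom a" "\<And>k. a k < CHAR('a)" by (auto simp: tmonoms_def PiE_def Pi_def)
      have "a k \<le> CHAR('a) - 1" for k using a(2)[of k] by simp
      then have "wmult g (partial j) \<in> witt_monoms"
        unfolding witt_monoms_def a(1) by blast
      then show "wmult g (partial j) \<in> witt.span witt_monoms" by (rule witt.span_base)
    qed
  qed
  then have "D \<in> witt.span witt_monoms" for D :: "('a, 'n) witt"
    by (subst witt_eq_sum_partial[of D]) (intro witt.span_sum)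
  then show ?thesis by auto
qed

lemma witt_monoms_grade:
  assumes "D \<in> witt_monoms"
  obtains d where "D \<in> witt_grade d" "d \<ge> -1" "d = -1 \<Longrightarrow> \<exists>j. D = partial j"
proof -
  obtain a j where D: "D = wmult (tmonom a) (partial j)" "\<forall>k. a k \<le> CHAR('a) - 1"
    using assms unfolding witt_monoms_def by blast
  show ?thesis
  proof (rule that[of "(\<Sum>k\<in>UNIV. int (a k)) - 1"])
    show "D \<in> witt_grade ((\<Sum>k\<in>UNIV. int (a k)) - 1)"
      unfolding witt_grade_def using D by (intro witt.span_base) blast
    show "(\<Sum>k\<in>UNIV. int (a k)) - 1 \<ge> -1"
      using sum_nonneg[of UNIV "\<lambda>k. int (a k)"] by simp
    assume "(\<Sum>k\<in>UNIV. int (a k)) - 1 = -1"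
    then have "a k = 0" for k by (simp add: sum_nonneg_eq_0_iff)
    then have "D = partial j"
      by (intro witt_eqI) (simp add: D(1) tmonom_def)
    then show "\<exists>j. D = partial j" ..
  qed
qed

lemma partials_nth: "k < CARD('n) \<Longrightarrow> partials ! k = partial (nth_var k :: 'n::{finite,linorder})"
  by (simp add: partials_def nth_var_def)

lemma length_partials [simp]: "length (partials :: ('a::field_prime_char, 'n::{finite,linorder}) witt list) = CARD('n)"
  by (simp add: partials_def)

lemma const_det_partials: "const_det (partials :: ('a::field_prime_char, 'n::{finite,linorder}) witt list) = 1"
proof -
  have "(\<chi> i. const_part (partials ! var_index i)) = (mat 1 :: ('a, 'n) sqmat)"
    by (simp add: vec_eq_iff mat_def const_part_def partials_nth der_apply_partial)
  then show ?thesis by (simp add: const_det_def)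
qed

text \<open>The existence half of \<open>lowest_coeff\<close>. After expansion in
  \<open>witt_monoms\<close>, a wedge either has a factor of degree above -1 and lies in higher
  degree, or consists of partial derivatives only; then it is zero if one repeats, and otherwise a
  permutation of \<open>wedge partials\<close>.\<close>

lemma wedge_lowest:
  fixes us :: "('a::field_prime_char, 'n::{finite,linorder}) witt list"
  assumes "length us = CARD('n)"
  shows "\<exists>c. wedge us - ext_scale c (wedge partials) \<in> ext_above CARD('n) (- int CARD('n))"
proof -
  let ?U = "\<Union>j\<in>{- int CARD('n)<..}. ext_grade CARD('n) j :: ('a, 'n) ext set"
  have "wedge vs \<in> ext.span (insert (wedge partials) ?U)"
    if vs: "set vs \<subseteq> witt_monoms" "length vs = CARD('n)" for vs :: "('a, 'n) witt list"
  proof -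
    have "\<exists>d. vs ! k \<in> witt_grade d \<and> d \<ge> -1 \<and> (d = -1 \<longrightarrow> (\<exists>j. vs ! k = partial j))" if "k < CARD('n)" for k
      using that vs witt_monoms_grade[of "vs ! k"] by (metis nth_mem subsetD)
    then obtain d where d: "\<And>k. k < CARD('n) \<Longrightarrow> vs ! k \<in> witt_grade (d k) \<and> d k \<ge> -1
        \<and> (d k = -1 \<longrightarrow> (\<exists>j. vs ! k = partial j))"
      by metis
    show ?thesis
    proof (cases "\<exists>k<CARD('n). d k \<noteq> -1")
      case True
      then obtain k where k: "k < CARD('n)" "d k \<noteq> -1" by blast
      have "(\<Sum>k<CARD('n). -1) < (\<Sum>k<CARD('n). d k)"
        by (rule sum_strict_mono_ex1) (use d k in \<open>auto intro!: bexI[of _ k] simp: less_le\<close>)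
      then have "(\<Sum>k<CARD('n). d k) > - int CARD('n)" by simp
      moreover have "wedge vs \<in> ext_grade CARD('n) (\<Sum>k<CARD('n). d k)"
        unfolding ext_grade_def using vs(2) d by (intro ext.span_base) blast
      ultimately have "wedge vs \<in> ?U" by blast
      then show ?thesis by (simp add: ext.span_base)
    next
      case False
      show ?thesis
      proof (cases "distinct vs")
        case True
        have "\<exists>j. x = partial j" if "x \<in> set vs" for x
          using that False d vs(2) by (metis in_set_conv_nth)
        then have "set vs \<subseteq> range (partial :: 'n \<Rightarrow> ('a, 'n) witt)" by auto
        moreover have "card (set vs) = CARD('n)" using True vs(2) by (simp add: distinct_card)
        moreover have "card (range (partial :: 'n \<Rightarrow> ('a, 'n) witt)) \<le> CARD('n)"
          by (rule card_image_le) simp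
        ultimately have "set vs = range (partial :: 'n \<Rightarrow> ('a, 'n) witt)"
          by (intro card_seteq) auto
        moreover have set_partials: "set (partials :: ('a, 'n) witt list) = range partial"
          by (simp add: partials_def)
        moreover have "inj (partial :: 'n \<Rightarrow> ('a, 'n) witt)"
          by (rule injI) (metis der_apply_partial zero_neq_one)
        then have "distinct (partials :: ('a, 'n) witt list)"
          by (simp add: partials_def distinct_map inj_on_subset)
        ultimately have "mset vs = mset partials"
          using True by (metis set_eq_iff_mset_eq_distinct)
        then have "wedge ([] @ vs) \<in> ext.span {wedge ([] @ partials)}"
          by (rule wedge_permute)
        then show ?thesis
          using ext.span_mono[of "{wedge partials}" "insert (wedge partials) ?U"] by auto
      qed (simp add: wedge_not_distinct ext.span_zero)
    qed
  qed
  then have "ext.span {wedge ([] @ vs) | vs. set vs \<subseteq> witt_monoms \<and> length vs = length us}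
      \<subseteq> ext.span (insert (wedge partials) ?U)"
    using assms by (intro ext.span_minimal) auto
  then have "wedge us \<in> ext.span (insert (wedge partials) ?U)"
    using wedge_expand[OF span_witt_monoms, of "[]" us] by auto
  then show ?thesis unfolding ext.span_breakdown_eq ext_above_def .
qed

text \<open>The form \<open>ext_det\<close> kills \<open>ext_above\<close> and takes the value 1 on
  \<open>wedge partials\<close>, so it reads off the coefficient.\<close>

lemma lowest_coeff_eq_const_det:
  fixes us :: "('a::field_prime_char, 'n::{finite,linorder}) witt list"
  assumes "length us = CARD('n)"
  shows "lowest_coeff us = const_det us"
proof -
  have c: "c = const_det us"
    if "wedge us - ext_scale c (wedge partials) \<in> ext_above CARD('n) (- int CARD('n))" for c
    using ext_det_above[OF that]
    by (simp add: ext_det_diff ext_det_scale ext_det_wedge const_det_partials)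
  obtain c where "wedge us - ext_scale c (wedge partials) \<in> ext_above CARD('n) (- int CARD('n))"
    using wedge_lowest[OF assms] by blast
  with c show ?thesis
    unfolding lowest_coeff_def by (intro the_equality) auto
qed

lemma Delta0_eq_det:
  "Delta0 D = det (\<chi> i. const_part (ppow (var_index i) D) :: ('a, 'n) sqmat)"
  for D :: "('a::field_prime_char, 'n::{finite,linorder}) witt"
  by (simp add: Delta0_def lowest_coeff_eq_const_det const_det_def)

lemma Delta_repl_eq_det:
  "Delta_repl m D = det (\<chi> i. if var_index i = m - 1 then const_part (ppow CARD('n) D)
     else const_part (ppow (var_index i) D) :: ('a, 'n) sqmat)"
  for D :: "('a::field_prime_char, 'n::{finite,linorder}) witt"
proof -
  have "(map (\<lambda>k. ppow k D) [0..<CARD('n)])[m - 1 := ppow CARD('n) D] ! var_index i =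
      (if var_index i = m - 1 then ppow CARD('n) D else ppow (var_index i) D)" for i :: 'n
    using var_index_less[of i]
    by (cases "var_index i = m - 1") (simp_all del: var_index_less)
  then show ?thesis
    by (simp only: Delta_repl_def lowest_coeff_eq_const_det const_det_def length_list_update
        length_map length_upt diff_zero refl if_True if_distrib[of const_part])
qed

section \<open>The filtration by powers of the maximal ideal\<close>

text \<open>The d-th power of the maximal ideal. Splitting off one variable at a time suits
  inductions by the Leibniz rule.\<close>

primrec ideal_power :: "nat \<Rightarrow> ('a::field_prime_char, 'n::finite) trunc set" where
  "ideal_power 0 = UNIV"
| "ideal_power (Suc d) = {\<Sum>i\<in>UNIV. g i * tvar i | g. \<forall>i. g i \<in> ideal_power d}"

lemma ideal_power_0: "0 \<in> ideal_power d"
  by (induction d) (auto intro!: exI[of _ "\<lambda>_. 0"])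

lemma ideal_power_add: "f \<in> ideal_power d \<Longrightarrow> g \<in> ideal_power d \<Longrightarrow> f + g \<in> ideal_power d"
proof (induction d arbitrary: f g)
  case (Suc d)
  then obtain a b where "f = (\<Sum>i\<in>UNIV. a i * tvar i)" "g = (\<Sum>i\<in>UNIV. b i * tvar i)"
    "\<And>i. a i \<in> ideal_power d" "\<And>i. b i \<in> ideal_power d"
    by auto
  then show ?case
    using Suc.IH
    by (auto intro!: exI[of _ "\<lambda>i. a i + b i"] simp: sum.distrib distrib_right)
qed simp

lemma ideal_power_mult: "f \<in> ideal_power d \<Longrightarrow> h * f \<in> ideal_power d"
proof (induction d arbitrary: f)
  case (Suc d)
  then obtain a where "f = (\<Sum>i\<in>UNIV. a i * tvar i)" "\<And>i. a i \<in> ideal_power d"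
    by auto
  then show ?case
    using Suc.IH
    by (auto intro!: exI[of _ "\<lambda>i. h * a i"] simp: sum_distrib_left mult.assoc)
qed simp

lemma ideal_power_mult': "f \<in> ideal_power d \<Longrightarrow> f * h \<in> ideal_power d"
  using ideal_power_mult[of f d h] by (simp add: mult.commute)

lemma ideal_power_uminus: "f \<in> ideal_power d \<Longrightarrow> - f \<in> ideal_power d"
  using ideal_power_mult[of f d "-1"] by simp

lemma ideal_power_diff: "f \<in> ideal_power d \<Longrightarrow> g \<in> ideal_power d \<Longrightarrow> f - g \<in> ideal_power d"
  using ideal_power_add[of f d "- g"] ideal_power_uminus[of g d] by simp

lemma ideal_power_sum: "(\<And>i. i \<in> A \<Longrightarrow> f i \<in> ideal_power d) \<Longrightarrow> (\<Sum>i\<in>A. f i) \<in> ideal_power d"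
  by (induction A rule: infinite_finite_induct) (simp_all add: ideal_power_0 ideal_power_add)

lemma ideal_power_Suc_tvar: "f \<in> ideal_power d \<Longrightarrow> f * tvar i \<in> ideal_power (Suc d)"
  by (auto intro!: exI[of _ "\<lambda>j. if j = i then f else 0"] simp: mult_delta_left ideal_power_0)

lemma ideal_power_SucD: "f \<in> ideal_power (Suc d) \<Longrightarrow> f \<in> ideal_power d"
proof (induction d arbitrary: f)
  case (Suc d)
  from Suc.prems obtain g where g: "f = (\<Sum>i\<in>UNIV. g i * tvar i)" "\<And>i. g i \<in> ideal_power (Suc d)"
    unfolding ideal_power.simps(2)[of "Suc d"] by blast
  then have "g i \<in> ideal_power d" for i using Suc.IH by blast
  then show ?case
    unfolding g(1) by (intro ideal_power_sum ideal_power_Suc_tvar)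
qed simp

lemma ideal_power_1: "ideal_power (Suc 0) = max_ideal"
  by (auto simp: max_ideal_def)

lemma ideal_power_times:
  "f \<in> ideal_power d \<Longrightarrow> g \<in> ideal_power e \<Longrightarrow> f * g \<in> ideal_power (d + e)"
proof (induction d arbitrary: f)
  case (Suc d)
  then obtain h where h: "f = (\<Sum>i\<in>UNIV. h i * tvar i)" "\<And>i. h i \<in> ideal_power d"
    by auto
  have "f * g = (\<Sum>i\<in>UNIV. (h i * g) * tvar i)"
    unfolding h(1) sum_distrib_right by (intro sum.cong refl) (simp add: mult_ac)
  moreover have "(h i * g) * tvar i \<in> ideal_power (Suc (d + e))" for i
    using Suc.IH[OF h(2) Suc.prems(2)] by (rule ideal_power_Suc_tvar)
  ultimately show ?case
    using ideal_power_sum[of UNIV "\<lambda>i. (h i * g) * tvar i" "Suc (d + e)"] by simp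
qed (simp add: ideal_power_mult)

lemma ideal_power_power: "f \<in> max_ideal \<Longrightarrow> f ^ m \<in> ideal_power m"
proof (induction m)
  case (Suc m)
  then show ?case
    using ideal_power_times[of f "Suc 0" "f ^ m" m] by (simp only: ideal_power_1) simp
qed simp

lemma ideal_power_prod:
  "(\<And>k. k \<in> A \<Longrightarrow> f k \<in> ideal_power (a k)) \<Longrightarrow> (\<Prod>k\<in>A. f k) \<in> ideal_power (\<Sum>k\<in>A. a k)"
  by (induction A rule: infinite_finite_induct) (simp_all add: ideal_power_times del: ideal_power.simps(2))

lemma der_apply_ideal_power: "f \<in> ideal_power (Suc d) \<Longrightarrow> der_apply D f \<in> ideal_power d"
proof (induction d arbitrary: f)
  case (Suc d)
  then obtain g where g: "f = (\<Sum>i\<in>UNIV. g i * tvar i)" "\<And>i. g i \<in> ideal_power (Suc d)"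
    by auto
  have "der_apply D (g i * tvar i) \<in> ideal_power (Suc d)" for i
    unfolding der_apply_mult using g(2)[of i] Suc.IH[OF g(2)]
    by (intro ideal_power_add ideal_power_mult' ideal_power_Suc_tvar)
  then show ?case
    by (simp only: g(1) der_apply_sum ideal_power_sum)
qed simp

text \<open>Here \<open>D\<close> maps each variable into the maximal ideal, so in the Leibniz rule
  the term that differentiates the variable loses no order either.\<close>

lemma der_apply_ideal_power':
  assumes "const_part D = 0"
  shows "f \<in> ideal_power d \<Longrightarrow> der_apply D f \<in> ideal_power d"
proof (induction d arbitrary: f)
  case (Suc d)
  then obtain g where g: "f = (\<Sum>i\<in>UNIV. g i * tvar i)" "\<And>i. g i \<in> ideal_power d"
    by auto
  have D: "der_apply D (tvar i) \<in> ideal_power (Suc 0)" for i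
    using assms unfolding ideal_power_1 max_ideal_iff by (simp add: const_part_def vec_eq_iff)
  have "g i * der_apply D (tvar i) \<in> ideal_power (Suc d)" for i
    using ideal_power_times[OF g(2)[of i] D[of i]] by simp
  then have "der_apply D (g i * tvar i) \<in> ideal_power (Suc d)" for i
    unfolding der_apply_mult using Suc.IH[OF g(2)]
    by (intro ideal_power_add ideal_power_Suc_tvar)
  then show ?case
    by (simp only: g(1) der_apply_sum ideal_power_sum)
qed simp

text \<open>In the expansion of \<open>D\<close> by partial derivatives, evaluation at the origin
  sees only the constant terms of the coefficients.\<close>

lemma ev_der_apply_eq_0:
  assumes "const_part D = 0"
  shows "ev (der_apply D f) = 0"
proof -
  have "der_apply D f = (\<Sum>j\<in>UNIV. der_apply D (tvar j) * der_apply (partial j) f)"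
    by (subst witt_eq_sum_partial[of D]) simp
  moreover have "ev (der_apply D (tvar j)) = 0" for j
    using assms by (simp add: const_part_def vec_eq_iff)
  ultimately show ?thesis by simp
qed

section \<open>Products of derivations\<close>

text \<open>The order of the factors is fixed, with \<open>V 0\<close> acting first, because the
  fields in \<open>V\<close> need not commute.\<close>

primrec der_prod ::
    "(nat \<Rightarrow> ('a::field_prime_char, 'n::finite) witt) \<Rightarrow> (nat \<Rightarrow> nat) \<Rightarrow> nat
      \<Rightarrow> ('a, 'n) trunc \<Rightarrow> ('a, 'n) trunc" where
  "der_prod V m 0 f = f"
| "der_prod V m (Suc k) f = (der_apply (V k) ^^ m k) (der_prod V m k f)"

text \<open>To leading order, a derivation acts as the constant vector field with the same constant part.\<close>

lemma der_apply_leading_part: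
  assumes E: "const_part E = const_part E'" and h: "h \<in> ideal_power (Suc s)" "h - h' \<in> ideal_power (Suc (Suc s))"
  shows "der_apply E h \<in> ideal_power s" "der_apply E h - der_apply E' h' \<in> ideal_power (Suc s)"
proof -
  show "der_apply E h \<in> ideal_power s" using h(1) by (rule der_apply_ideal_power)
  have "h - h' \<in> ideal_power (Suc s)" using h(2) by (rule ideal_power_SucD)
  then have "h - (h - h') \<in> ideal_power (Suc s)" using h(1) by (rule ideal_power_diff[rotated])
  then have h': "h' \<in> ideal_power (Suc s)" by simp
  have "const_part (E - E') = 0" using E by (simp add: const_part_def vec_eq_iff)
  \<comment> \<open>Split E h - E' h' as E (h - h') + (E - E') h': in the first term the argument
    has higher order, in the second the field has no constant part.\<close>
  from der_apply_ideal_power'[OF this h'] der_apply_ideal_power[OF h(2), of E]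
  have "der_apply E (h - h') + der_apply (E - E') h' \<in> ideal_power (Suc s)"
    by (intro ideal_power_add)
  then show "der_apply E h - der_apply E' h' \<in> ideal_power (Suc s)" by (simp del: ideal_power.simps)
qed

lemma der_apply_funpow_leading_part:
  assumes E: "const_part E = const_part E'"
  shows "h \<in> ideal_power (s + m) \<Longrightarrow> h - h' \<in> ideal_power (Suc (s + m)) \<Longrightarrow>
    (der_apply E ^^ m) h \<in> ideal_power s \<and>
    (der_apply E ^^ m) h - (der_apply E' ^^ m) h' \<in> ideal_power (Suc s)"
proof (induction m arbitrary: s)
  case (Suc m)
  then show ?case
    using der_apply_leading_part[OF E, of "(der_apply E ^^ m) h" s "(der_apply E' ^^ m) h'"]
    by (simp del: ideal_power.simps)
qed simp

text \<open>Each application lowers the guaranteed order of the main term and of the error by one,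
  so the error stays one order ahead.\<close>

lemma der_prod_leading_part:
  assumes "\<And>k. k < n \<Longrightarrow> const_part (V k) = const_part (W k)"
    and "f \<in> ideal_power (s + (\<Sum>k<n. m k))"
  shows "der_prod V m n f \<in> ideal_power s \<and> der_prod V m n f - der_prod W m n f \<in> ideal_power (Suc s)"
  using assms
proof (induction n arbitrary: s)
  case (Suc n)
  have "der_prod V m n f \<in> ideal_power (s + m n) \<and>
      der_prod V m n f - der_prod W m n f \<in> ideal_power (Suc (s + m n))"
    using Suc.prems by (intro Suc.IH) (simp_all add: add_ac)
  then show ?case
    using der_apply_funpow_leading_part[of "V n" "W n" "der_prod V m n f" s "m n" "der_prod W m n f"]
      Suc.prems(1)[of n]
    by (simp del: ideal_power.simps)
qed (simp add: ideal_power_0 del: ideal_power.simps(2))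

text \<open>The falling factorial, the coefficient in the m-th derivative of a power. For
  \<open>m > a\<close> the factor with \<open>i = a\<close> makes it zero, as it should be.\<close>

definition falling :: "nat \<Rightarrow> nat \<Rightarrow> nat" where
  "falling a m = (\<Prod>i<m. a - i)"

lemma falling_self: "falling a a = fact a"
  unfolding falling_def by (subst fact_prod_rev) (simp add: atLeast0LessThan)

lemma falling_eq_0: "a < m \<Longrightarrow> falling a m = 0"
  unfolding falling_def by (auto intro: bexI[of _ a])

lemma der_apply_funpow_power:
  assumes "der_apply D z = 1" "der_apply D g = 0"
  shows "(der_apply D ^^ m) (z ^ a * g) = of_nat (falling a m) * z ^ (a - m) * g"
proof (induction m)
  case (Suc m)
  have pow: "der_apply D (z ^ k) = of_nat k * z ^ (k - 1)" for k
  proof (induction k)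
    case (Suc k)
    then show ?case by (cases k) (simp_all add: der_apply_mult assms algebra_simps)
  qed simp
  have nat: "der_apply D (of_nat k) = 0" for k :: nat
    by (induction k) simp_all
  have "(der_apply D ^^ Suc m) (z ^ a * g) = der_apply D (of_nat (falling a m) * z ^ (a - m) * g)"
    by (simp add: Suc)
  also have "\<dots> = of_nat (falling a m) * (of_nat (a - m) * z ^ (a - m - 1)) * g"
    by (simp add: der_apply_mult nat assms(2) pow)
  also have "\<dots> = of_nat (falling a (Suc m)) * z ^ (a - Suc m) * g"
    by (simp add: falling_def mult_ac)
  finally show ?case .
qed (simp add: falling_def)

text \<open>For \<open>W j\<close> every coordinate except \<open>z j\<close> is a constant, so each
  step differentiates a single factor. The products over \<open>{..<j}\<close> and
  \<open>{j..<n}\<close> are the factors already treated and those still to come.\<close>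

lemma der_prod_coordinates:
  assumes z: "\<And>k l. k < n \<Longrightarrow> l < n \<Longrightarrow> der_apply (W k) (z l) = (if k = l then 1 else 0)"
  shows "j \<le> n \<Longrightarrow> der_prod W m j (\<Prod>l<n. z l ^ a l) =
    (\<Prod>l<j. of_nat (falling (a l) (m l)) * z l ^ (a l - m l)) * (\<Prod>l\<in>{j..<n}. z l ^ a l)"
proof (induction j)
  case 0
  show ?case by (simp add: atLeast0LessThan)
next
  case (Suc j)
  let ?g = "(\<Prod>l<j. of_nat (falling (a l) (m l)) * z l ^ (a l - m l)) * (\<Prod>l\<in>{Suc j..<n}. z l ^ a l)"
  have nat: "der_apply (W j) (of_nat k) = 0" for k :: nat
    by (induction k) simp_all
  have 1: "der_apply (W j) (of_nat (falling (a l) (m l)) * z l ^ (a l - m l)) = 0" if "l < j" for l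
    using that Suc.prems z[of j l] by (simp add: der_apply_mult nat der_apply_power_eq_0)
  have 2: "der_apply (W j) (z l ^ a l) = 0" if "l \<in> {Suc j..<n}" for l
    using that Suc.prems z[of j l] by (simp add: der_apply_power_eq_0)
  have g: "der_apply (W j) ?g = 0"
    using der_apply_prod_eq_0[of "{..<j}", OF 1] der_apply_prod_eq_0[of "{Suc j..<n}", OF 2]
    by (simp add: der_apply_mult)
  have "{j..<n} = insert j {Suc j..<n}" using Suc.prems by auto
  then have "der_prod W m j (\<Prod>l<n. z l ^ a l) = z j ^ a j * ?g"
    using Suc by (simp add: mult_ac)
  moreover have "der_apply (W j) (z j) = 1" using z[of j j] Suc.prems by simp
  ultimately show ?case
    using der_apply_funpow_power[OF _ g, of "z j" "m j" "a j"] by (simp add: mult_ac)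
qed

section \<open>Digits in base \<open>p\<close>\<close>

definition digit :: "nat \<Rightarrow> nat \<Rightarrow> nat \<Rightarrow> nat" where
  "digit p b k = b div p ^ k mod p"

lemma mod_power_Suc: "b mod p ^ Suc k = p ^ k * digit p b k + b mod p ^ k" for p :: nat
  using mod_mult2_eq[of b "p ^ k" p] by (simp add: digit_def mult.commute)

lemma digit_inj:
  assumes "a < p ^ n" "b < p ^ n" "\<And>k. k < n \<Longrightarrow> digit p a k = digit p b k"
  shows "a = b"
proof -
  have "a mod p ^ k = b mod p ^ k" if "k \<le> n" for k
    using that assms(3) by (induction k) (simp_all add: mod_power_Suc del: power_Suc)
  from this[of n] show ?thesis using assms(1,2) by simp
qed

text \<open>The k-th digit d contributes d applications of D^(p^k), and \<open>m mod p ^ j\<close>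
  is the number formed by the lowest j digits.\<close>

lemma der_prod_digits:
  fixes D :: "('a::field_prime_char, 'n::finite) witt"
  shows "der_prod (\<lambda>k. ppow k D) (digit CHAR('a) m) j f = (der_apply D ^^ (m mod CHAR('a) ^ j)) f"
proof (induction j)
  case (Suc j)
  show ?case
    unfolding mod_power_Suc
    by (simp add: Suc funpow_add der_apply_ppow funpow_mult)
qed simp

lemma of_nat_fact_nonzero: "m < CHAR('a) \<Longrightarrow> of_nat (fact m) \<noteq> (0 :: 'a::field_prime_char)"
  unfolding of_nat_eq_0_iff_char_dvd by (simp add: prime_dvd_fact_iff prime_CHAR)

section \<open>Graded triangular systems\<close>

text \<open>Choose \<open>b\<close> of maximal weight in the support of \<open>c\<close>; in its
  equation only the diagonal term survives. Weights are integers so that a change of sign handles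
  the transposed system.\<close>

lemma graded_triangular_kernel:
  fixes T :: "'i \<Rightarrow> 'i \<Rightarrow> 'a::field" and wt :: "'i \<Rightarrow> int"
  assumes I: "finite I" and diag: "\<And>m. m \<in> I \<Longrightarrow> T m m \<noteq> 0"
    and tri: "\<And>m b. m \<in> I \<Longrightarrow> b \<in> I \<Longrightarrow> m \<noteq> b \<Longrightarrow> wt m \<le> wt b \<Longrightarrow> T m b = 0"
    and c: "\<And>b. b \<in> I \<Longrightarrow> (\<Sum>m\<in>I. c m * T m b) = 0" and "m \<in> I"
  shows "c m = 0"
proof (rule ccontr)
  assume "c m \<noteq> 0"
  let ?S = "{m \<in> I. c m \<noteq> 0}"
  have S: "finite (wt ` ?S)" "wt ` ?S \<noteq> {}" using I \<open>m \<in> I\<close> \<open>c m \<noteq> 0\<close> by auto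
  from Max_in[OF S] obtain b where b: "b \<in> I" "c b \<noteq> 0" "wt b = Max (wt ` ?S)" by auto
  have "c k * T k b = 0" if "k \<in> I - {b}" for k
    using that b tri[of k b] Max_ge[OF S(1), of "wt k"] by (cases "c k = 0") auto
  then have "(\<Sum>m\<in>I. c m * T m b) = c b * T b b"
    using I b(1) by (simp add: sum.remove[of I b] sum.neutral)
  then show False using c[OF b(1)] b(2) diag[OF b(1)] by simp
qed

lemma trunc_independent_family:
  assumes I: "finite I"
    and ind: "\<And>d b. (\<Sum>b\<in>I. tscale (d b) (v b)) = 0 \<Longrightarrow> b \<in> I \<Longrightarrow> d b = 0"
  shows "inj_on v I" "trunc.independent (v ` I)"
proof -
  show inj: "inj_on v I"
  proof (rule inj_onI, rule ccontr)
    fix a b assume ab: "a \<in> I" "b \<in> I" "v a = v b" "a \<noteq> b"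
    have "(\<Sum>k\<in>I. tscale (if k = a then 1 else if k = b then - 1 else 0) (v k)) =
        (\<Sum>k\<in>{a, b}. tscale (if k = a then 1 else if k = b then - 1 else 0) (v k))"
      using ab I by (intro sum.mono_neutral_right) auto
    also have "\<dots> = 0" using ab by simp
    finally show False using ind[of "\<lambda>k. if k = a then 1 else if k = b then - 1 else 0" a] ab by simp
  qed
  show "trunc.independent (v ` I)"
  proof
    assume "trunc.dependent (v ` I)"
    then obtain u b where u: "b \<in> I" "u (v b) \<noteq> 0" "(\<Sum>x\<in>v ` I. tscale (u x) x) = 0"
      using I by (auto simp: trunc.dependent_finite)
    then have "(\<Sum>b\<in>I. tscale (u (v b)) (v b)) = 0" by (simp add: sum.reindex[OF inj])
    from ind[OF this u(1)] u(2) show False by simp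
  qed
qed

section \<open>Derivations with nonvanishing lowest coefficient\<close>

locale generic_witt =
  fixes D :: "('a::field_prime_char, 'n::{finite,linorder}) witt"
  assumes Delta0_nonzero: "Delta0 D \<noteq> 0"
begin

definition M :: "('a, 'n) sqmat" where
  "M = (\<chi> i. const_part (ppow (var_index i) D))"

lemma det_M: "det M = Delta0 D"
  by (simp add: M_def Delta0_eq_det)

lemma M_inverse: "M ** matrix_inv M = mat 1"
proof -
  have "invertible M" using Delta0_nonzero by (simp add: invertible_det_nz det_M)
  then show ?thesis
    unfolding invertible_def matrix_inv_def by (rule someI2_ex) simp
qed

text \<open>The field with constant coefficients that agrees with \<open>ppow k D\<close> at the
  origin.\<close>

definition const_field :: "nat \<Rightarrow> ('a, 'n) witt" where
  "const_field k = (\<Sum>j\<in>UNIV. wscale (M $ nth_var k $ j) (partial j))"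

text \<open>The linear coordinates dual to the constant parts of \<open>D, D\<^sup>p, D\<^bsup>p^2\<^esup>, \<dots>\<close>\<close>

definition coord :: "nat \<Rightarrow> ('a, 'n) trunc" where
  "coord k = (\<Sum>j\<in>UNIV. tconst (matrix_inv M $ j $ nth_var k) * tvar j)"

lemma const_field_tvar: "der_apply (const_field k) (tvar i) = tconst (M $ nth_var k $ i)"
  by (simp add: const_field_def der_apply_partial tscale_def mult_delta_right)

lemma const_part_const_field:
  assumes "k < CARD('n)"
  shows "const_part (ppow k D) = const_part (const_field k)"
  using assms by (simp add: const_part_def[of "const_field k"] const_field_tvar vec_eq_iff) (simp add: M_def)

lemma const_field_coord:
  assumes "k < CARD('n)" "l < CARD('n)"
  shows "der_apply (const_field k) (coord l) = (if k = l then 1 else 0)"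
proof -
  have tsum: "(\<Sum>j\<in>A. tconst (h j)) = (tconst (\<Sum>j\<in>A. h j) :: ('a, 'n) trunc)" for h and A :: "'n set"
    by (induction A rule: infinite_finite_induct) (simp_all add: tconst_0 tconst_add)
  have "der_apply (const_field k) (coord l) =
      tconst (\<Sum>j\<in>UNIV. matrix_inv M $ j $ nth_var l * M $ nth_var k $ j)"
    by (simp add: coord_def const_field_tvar tconst_mult[symmetric] tsum)
  also have "(\<Sum>j\<in>UNIV. matrix_inv M $ j $ nth_var l * M $ nth_var k $ j) =
      (M ** matrix_inv M) $ nth_var k $ nth_var l"
    by (simp add: matrix_matrix_mult_def mult.commute)
  also have "\<dots> = (if k = l then 1 else 0)"
    using assms by (auto simp: M_inverse mat_def) (metis index_nth_var)
  finally show ?thesis by (auto simp: tconst_1 tconst_0)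
qed

lemma coord_in_max_ideal: "coord k \<in> max_ideal"
  by (simp add: max_ideal_iff coord_def)

text \<open>The digit sum is both the degree of \<open>coord_monom b\<close> in the coordinates and
  the number of derivations D^(p^k) composed in D^b.\<close>

definition weight :: "nat \<Rightarrow> nat" where
  "weight b = (\<Sum>k<CARD('n). digit CHAR('a) b k)"

definition coord_monom :: "nat \<Rightarrow> ('a, 'n) trunc" where
  "coord_monom b = (\<Prod>k<CARD('n). coord k ^ digit CHAR('a) b k)"

text \<open>The triangularity. A monomial of degree above \<open>weight m\<close> keeps positive
  order under D^m and vanishes at the origin. In equal degree only the leading part counts, where
  D^m acts as an iterated partial derivative in the coordinates.\<close>

lemma ev_funpow_coord_monom:
  assumes "m < CHAR('a) ^ CARD('n)" "b < CHAR('a) ^ CARD('n)" "weight m \<le> weight b"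
  shows "ev ((der_apply D ^^ m) (coord_monom b)) =
    (if m = b then of_nat (\<Prod>k<CARD('n). fact (digit CHAR('a) m k)) else 0)"
proof -
  have D: "(der_apply D ^^ m) f = der_prod (\<lambda>k. ppow k D) (digit CHAR('a) m) CARD('n) f" for f
    using assms(1) by (simp add: der_prod_digits)
  have Z: "coord_monom b \<in> ideal_power (weight b)"
    unfolding coord_monom_def weight_def
    by (intro ideal_power_prod ideal_power_power coord_in_max_ideal)
  have lead: "der_prod (\<lambda>k. ppow k D) (digit CHAR('a) m) CARD('n) f \<in> ideal_power s \<and>
      der_prod (\<lambda>k. ppow k D) (digit CHAR('a) m) CARD('n) f - der_prod const_field (digit CHAR('a) m) CARD('n) f \<in> ideal_power (Suc s)"
    if "f \<in> ideal_power (s + weight m)" for f s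
    using that unfolding weight_def by (intro der_prod_leading_part const_part_const_field)
  show ?thesis
  proof (cases "weight m = weight b")
    case False
    then obtain s where "weight b = Suc s + weight m"
      using assms(3) by (metis add.commute add_Suc_right le_neq_implies_less less_imp_Suc_add)
    then have "der_prod (\<lambda>k. ppow k D) (digit CHAR('a) m) CARD('n) (coord_monom b) \<in> ideal_power (Suc s)"
      using lead[of "coord_monom b" "Suc s"] Z by simp
    moreover have "ideal_power (Suc s) \<subseteq> (max_ideal :: ('a, 'n) trunc set)"
      by (auto simp: max_ideal_def)
    ultimately have "ev ((der_apply D ^^ m) (coord_monom b)) = 0"
      by (auto simp: D max_ideal_iff[symmetric])
    then show ?thesis using False by auto
  next
    case True
    have "ev ((der_apply D ^^ m) (coord_monom b)) = ev (der_prod const_field (digit CHAR('a) m) CARD('n) (coord_monom b))"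
      using lead[of "coord_monom b" 0] Z True
      by (simp add: D ideal_power_1 max_ideal_iff del: ideal_power.simps(2))
    also have "\<dots> = (\<Prod>k<CARD('n). of_nat (falling (digit CHAR('a) b k) (digit CHAR('a) m k)) *
        ev (coord k) ^ (digit CHAR('a) b k - digit CHAR('a) m k))"
      unfolding coord_monom_def
      by (subst der_prod_coordinates[where n = "CARD('n)"]) (simp_all add: const_field_coord)
    also have "\<dots> = (if m = b then of_nat (\<Prod>k<CARD('n). fact (digit CHAR('a) m k)) else 0)"
    proof (cases "m = b")
      case False
      \<comment> \<open>Different digit vectors with the same sum: somewhere \<open>m\<close> has
        the larger digit, and differentiating that often kills the coordinate power.\<close>
      have "\<exists>k<CARD('n). digit CHAR('a) b k < digit CHAR('a) m k"
      proof (rule ccontr)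
        assume "\<not> ?thesis"
        then have le: "digit CHAR('a) m k \<le> digit CHAR('a) b k" if "k < CARD('n)" for k
          using that by (meson not_le)
        have "digit CHAR('a) m k = digit CHAR('a) b k" if "k < CARD('n)" for k
        proof (rule ccontr)
          assume "digit CHAR('a) m k \<noteq> digit CHAR('a) b k"
          then have "weight m < weight b"
            unfolding weight_def using le that
            by (intro sum_strict_mono_ex1) (auto intro!: bexI[of _ k] simp: less_le)
          then show False using True by simp
        qed
        then show False using digit_inj[OF assms(1,2)] False by blast
      qed
      then obtain k where k: "k < CARD('n)" "digit CHAR('a) b k < digit CHAR('a) m k" by blast
      then show ?thesis
        using False by (auto simp: falling_eq_0 intro!: prod_zero bexI[of _ k])
    qed (simp add: falling_self of_nat_prod)
    finally show ?thesis .
  qed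
qed

lemma fact_digits_nonzero: "of_nat (\<Prod>k<CARD('n). fact (digit CHAR('a) m k)) \<noteq> (0 :: 'a)"
proof -
  have "of_nat (fact (digit CHAR('a) m k)) \<noteq> (0 :: 'a)" for k
    by (rule of_nat_fact_nonzero) (simp add: digit_def)
  then show ?thesis by (simp only: of_nat_prod prod_zero_iff finite_lessThan) blast
qed

lemma ev_funpow_independent:
  assumes "\<And>f. (\<Sum>m<CHAR('a) ^ CARD('n). c m * ev ((der_apply D ^^ m) f)) = 0" "m < CHAR('a) ^ CARD('n)"
  shows "c m = 0"
proof (rule graded_triangular_kernel[where I = "{..<CHAR('a) ^ CARD('n)}" and wt = "int \<circ> weight"
      and T = "\<lambda>m b. ev ((der_apply D ^^ m) (coord_monom b))"])
  fix m assume "m \<in> {..<CHAR('a) ^ CARD('n)}"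
  then show "ev ((der_apply D ^^ m) (coord_monom m)) \<noteq> 0"
    using fact_digits_nonzero by (simp add: ev_funpow_coord_monom)
qed (use assms in \<open>simp_all add: ev_funpow_coord_monom\<close>)

text \<open>The same triangular matrix, read along its other index with the sign of the weights
  reversed.\<close>

lemma coord_monom_independent:
  assumes "(\<Sum>b<CHAR('a) ^ CARD('n). tscale (d b) (coord_monom b)) = 0" "b < CHAR('a) ^ CARD('n)"
  shows "d b = 0"
proof (rule graded_triangular_kernel[where I = "{..<CHAR('a) ^ CARD('n)}" and wt = "\<lambda>b. - int (weight b)"
      and T = "\<lambda>b m. ev ((der_apply D ^^ m) (coord_monom b))"])
  fix m assume "m \<in> {..<CHAR('a) ^ CARD('n)}"
  then show "ev ((der_apply D ^^ m) (coord_monom m)) \<noteq> 0"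
    using fact_digits_nonzero by (simp add: ev_funpow_coord_monom)
next
  fix m
  have add: "(der_apply D ^^ m) (f + g) = (der_apply D ^^ m) f + (der_apply D ^^ m) g" for f g
    by (induction m) simp_all
  have scale: "(der_apply D ^^ m) (tscale c f) = tscale c ((der_apply D ^^ m) f)" for c f
    by (induction m) simp_all
  have zero: "(der_apply D ^^ m) 0 = 0" by (induction m) simp_all
  have "(der_apply D ^^ m) (\<Sum>b\<in>A. tscale (d b) (coord_monom b)) =
      (\<Sum>b\<in>A. tscale (d b) ((der_apply D ^^ m) (coord_monom b)))" for A
    by (induction A rule: infinite_finite_induct) (simp_all add: add scale zero)
  from this[of "{..<CHAR('a) ^ CARD('n)}"] have "ev (\<Sum>b<CHAR('a) ^ CARD('n). tscale (d b) ((der_apply D ^^ m) (coord_monom b))) = 0"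
    using assms(1) zero by simp
  then show "(\<Sum>b<CHAR('a) ^ CARD('n). d b * ev ((der_apply D ^^ m) (coord_monom b))) = 0"
    by simp
qed (use assms in \<open>simp_all add: ev_funpow_coord_monom\<close>)

text \<open>The dimension is squeezed between the independent coordinate monomials and the spanning
  set \<open>tmonoms\<close>, both bounds being p^n.\<close>

lemma card_basis:
  assumes "trunc.independent B" "trunc.span B = (UNIV :: ('a, 'n) trunc set)"
  shows "finite B" "card B = CHAR('a) ^ CARD('n)"
proof -
  have fin: "finite B \<and> card B \<le> card (tmonoms :: ('a, 'n) trunc set)"
    using assms(1) by (intro trunc.independent_span_bound finite_tmonoms) (simp_all add: span_tmonoms)
  then show "finite B" by simp
  have ind: "inj_on coord_monom {..<CHAR('a) ^ CARD('n)}" "trunc.independent (coord_monom ` {..<CHAR('a) ^ CARD('n)})"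
    using trunc_independent_family[of "{..<CHAR('a) ^ CARD('n)}" coord_monom] coord_monom_independent by blast+
  have "card (coord_monom ` {..<CHAR('a) ^ CARD('n)}) \<le> card B"
    using trunc.independent_span_bound[OF \<open>finite B\<close> ind(2)] assms(2) by simp
  then show "card B = CHAR('a) ^ CARD('n)"
    using fin card_tmonoms_le[where ?'a = 'a and ?'n = 'n] by (simp add: card_image[OF ind(1)])
qed

end

section \<open>The Cayley-Hamilton theorem\<close>

text \<open>The module structure over the polynomial ring in which the indeterminate acts as
  \<open>D\<close>.\<close>

definition poly_act ::
    "('a::field_prime_char, 'n::finite) witt \<Rightarrow> 'a poly \<Rightarrow> ('a, 'n) trunc \<Rightarrow> ('a, 'n) trunc" where
  "poly_act D q f = (\<Sum>i\<le>degree q. tscale (coeff q i) ((der_apply D ^^ i) f))"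

lemma funpow_der_add: "(der_apply D ^^ m) (f + g) = (der_apply D ^^ m) f + (der_apply D ^^ m) g"
  and funpow_der_tscale: "(der_apply D ^^ m) (tscale c f) = tscale c ((der_apply D ^^ m) f)"
  and funpow_der_0: "(der_apply D ^^ m) 0 = 0"
  by (induction m) simp_all

lemma poly_act_le:
  "degree q \<le> m \<Longrightarrow> poly_act D q f = (\<Sum>i\<le>m. tscale (coeff q i) ((der_apply D ^^ i) f))"
  unfolding poly_act_def by (intro sum.mono_neutral_left) (auto simp: coeff_eq_0)

lemma poly_act_pCons: "poly_act D (pCons a q) f = tscale a f + der_apply D (poly_act D q f)"
  by (simp add: poly_act_le[OF degree_pCons_le] sum.atMost_Suc_shift del: sum.atMost_Suc)
    (simp add: poly_act_def)

lemma poly_act_0 [simp]: "poly_act D 0 f = 0"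
  by (simp add: poly_act_def)

lemma poly_act_add: "poly_act D (q + r) f = poly_act D q f + poly_act D r f"
  using poly_act_le[of q "max (degree q) (degree r)" D f]
    poly_act_le[of r "max (degree q) (degree r)" D f]
    poly_act_le[OF degree_add_le_max[of q r], of D f]
  by (simp add: trunc.scale_left_distrib sum.distrib)

lemma poly_act_smult: "poly_act D (smult c q) f = tscale c (poly_act D q f)"
  by (induction q) (simp_all add: poly_act_pCons trunc.scale_right_distrib)

lemma poly_act_mult: "poly_act D (q * r) f = poly_act D q (poly_act D r f)"
  by (induction q) (simp_all add: poly_act_pCons poly_act_add poly_act_smult)

lemma poly_act_sum: "poly_act D (\<Sum>i\<in>A. q i) f = (\<Sum>i\<in>A. poly_act D (q i) f)"
  by (induction A rule: infinite_finite_induct) (simp_all add: poly_act_add)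

lemma poly_act_add_right: "poly_act D q (f + g) = poly_act D q f + poly_act D q g"
  and poly_act_tscale_right: "poly_act D q (tscale c f) = tscale c (poly_act D q f)"
  and poly_act_0_right [simp]: "poly_act D q 0 = 0"
  by (simp_all add: poly_act_def funpow_der_add funpow_der_tscale funpow_der_0
      trunc.scale_right_distrib sum.distrib trunc.scale_sum_right mult.commute)

lemma poly_act_sum_right: "poly_act D q (\<Sum>i\<in>A. f i) = (\<Sum>i\<in>A. poly_act D q (f i))"
  by (induction A rule: infinite_finite_induct) (simp_all add: poly_act_add_right)

text \<open>Literally the choice made inside \<open>endo_char_poly\<close>, so that both speak of
  the same basis.\<close>

definition trunc_basis :: "('a::field_prime_char, 'n::finite) trunc list" where
  "trunc_basis = (SOME bs. distinct bs \<and> trunc.independent (set bs) \<and> trunc.span (set bs) = UNIV)"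

lemma trunc_basis:
  "distinct (trunc_basis :: ('a::field_prime_char, 'n::finite) trunc list)"
  "trunc.independent (set (trunc_basis :: ('a, 'n) trunc list))"
  "trunc.span (set (trunc_basis :: ('a, 'n) trunc list)) = UNIV"
proof -
  obtain B where B: "B \<subseteq> (tmonoms :: ('a, 'n) trunc set)" "trunc.independent B" "tmonoms \<subseteq> trunc.span B"
    using trunc.maximal_independent_subset by blast
  have "trunc.span B = UNIV"
    using trunc.span_minimal[OF B(3) trunc.subspace_span] by (auto simp: span_tmonoms)
  moreover obtain bs where "set bs = B" "distinct bs"
    using finite_distinct_list[of B] B(1) finite_tmonoms finite_subset by blast
  ultimately have "\<exists>bs :: ('a, 'n) trunc list. distinct bs \<and> trunc.independent (set bs) \<and> trunc.span (set bs) = UNIV"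
    using B(2) by blast
  from someI_ex[OF this] show "distinct (trunc_basis :: ('a, 'n) trunc list)"
    "trunc.independent (set (trunc_basis :: ('a, 'n) trunc list))"
    "trunc.span (set (trunc_basis :: ('a, 'n) trunc list)) = UNIV"
    unfolding trunc_basis_def by blast+
qed

definition trunc_coord :: "nat \<Rightarrow> ('a::field_prime_char, 'n::finite) trunc \<Rightarrow> 'a" where
  "trunc_coord i f = trunc.representation (set trunc_basis) f (trunc_basis ! i)"

lemma trunc_coord_add: "trunc_coord i (f + g) = trunc_coord i f + trunc_coord i g"
  and trunc_coord_tscale: "trunc_coord i (tscale c f) = c * trunc_coord i f"
  by (simp_all add: trunc_coord_def trunc.representation_add trunc.representation_scale trunc_basis)

lemma sum_trunc_coord:
  "(\<Sum>i<length (trunc_basis :: ('a::field_prime_char, 'n::finite) trunc list).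
      tscale (trunc_coord i f) (trunc_basis ! i)) = (f :: ('a, 'n) trunc)"
proof -
  have "(\<Sum>b\<in>set trunc_basis. tscale (trunc.representation (set trunc_basis) f b) b) = f"
    by (rule trunc.sum_representation_eq) (simp_all add: trunc_basis)
  then show ?thesis
    using sum.reindex_bij_betw[OF bij_betw_nth[OF trunc_basis(1)[where ?'a = 'a and ?'n = 'n] refl refl],
        of "\<lambda>b. tscale (trunc.representation (set trunc_basis) f b) b"]
    by (simp add: trunc_coord_def)
qed

definition basis_mat :: "('a::field_prime_char, 'n::finite) witt \<Rightarrow> 'a Matrix.mat" where
  "basis_mat D = Matrix.mat (length (trunc_basis :: ('a, 'n) trunc list)) (length (trunc_basis :: ('a, 'n) trunc list))
     (\<lambda>(i, j). trunc_coord i (der_apply D (trunc_basis ! j)))"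

lemma basis_mat_carrier:
  "basis_mat (D :: ('a::field_prime_char, 'n::finite) witt) \<in>
    carrier_mat (length (trunc_basis :: ('a, 'n) trunc list)) (length (trunc_basis :: ('a, 'n) trunc list))"
  by (simp add: basis_mat_def)

lemma endo_char_poly_eq: "endo_char_poly (der_apply D) = char_poly (basis_mat D)"
  by (simp add: endo_char_poly_def basis_mat_def trunc_coord_def trunc_basis_def Let_def)

text \<open>The adjugate argument: the matrix t I - A over the polynomial ring annihilates the basis
  vectors through \<open>poly_act\<close>, and multiplying by its adjugate leaves the characteristic
  polynomial on the diagonal.\<close>

lemma cayley_hamilton:
  fixes D :: "('a::field_prime_char, 'n::finite) witt"
  shows "poly_act D (char_poly (basis_mat D)) f = 0"
proof -
  let ?b = "trunc_basis :: ('a, 'n) trunc list"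
  let ?N = "length ?b"
  let ?A = "basis_mat D"
  let ?C = "char_poly_matrix ?A"
  let ?P = "adj_mat ?C"
  have C: "?C \<in> carrier_mat ?N ?N" using basis_mat_carrier[of D] by (rule char_poly_matrix_closed)
  have P: "?P \<in> carrier_mat ?N ?N" using adj_mat(1)[OF C] .
  \<comment> \<open>Column \<open>j\<close> says that D applied to the j-th basis vector equals its
    own expansion in the basis.\<close>
  have col: "(\<Sum>i<?N. poly_act D (?C $$ (i, j)) (?b ! i)) = 0" if j: "j < ?N" for j
  proof -
    have "?C $$ (i, j) = (if i = j then [:0, 1:] else 0) + [:- trunc_coord i (der_apply D (?b ! j)):]"
      if "i < ?N" for i
      using that j by (simp add: char_poly_matrix_def basis_mat_def)
    then have "(\<Sum>i<?N. poly_act D (?C $$ (i, j)) (?b ! i)) =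
        (\<Sum>i<?N. poly_act D (if i = j then [:0, 1:] else 0) (?b ! i))
        - (\<Sum>i<?N. tscale (trunc_coord i (der_apply D (?b ! j))) (?b ! i))"
      by (simp add: poly_act_add poly_act_pCons sum_subtractf[symmetric])
    also have "(\<Sum>i<?N. poly_act D (if i = j then [:0, 1:] else 0) (?b ! i)) =
        (\<Sum>i<?N. if i = j then der_apply D (?b ! i) else 0)"
      by (intro sum.cong) (simp_all add: poly_act_pCons)
    also have "\<dots> = der_apply D (?b ! j)" using j by simp
    finally show ?thesis by (simp add: sum_trunc_coord)
  qed
  have basis: "poly_act D (char_poly ?A) (?b ! l) = 0" if l: "l < ?N" for l
  proof -
    have CP: "(\<Sum>j<?N. ?C $$ (i, j) * ?P $$ (j, l)) = (if i = l then char_poly ?A else 0)" if "i < ?N" for i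
    proof -
      have "(?C * ?P) $$ (i, l) = (\<Sum>j<?N. ?C $$ (i, j) * ?P $$ (j, l))"
        using that l C P by (simp add: scalar_prod_def atLeast0LessThan)
      moreover have "(?C * ?P) $$ (i, l) = (if i = l then char_poly ?A else 0)"
        unfolding adj_mat(2)[OF C] using that l by (simp add: char_poly_def)
      ultimately show ?thesis by simp
    qed
    have "poly_act D (char_poly ?A) (?b ! l) =
        (\<Sum>i<?N. if i = l then poly_act D (char_poly ?A) (?b ! i) else 0)"
      using l by simp
    also have "\<dots> = (\<Sum>i<?N. poly_act D (\<Sum>j<?N. ?C $$ (i, j) * ?P $$ (j, l)) (?b ! i))"
      by (intro sum.cong) (simp_all add: CP)
    also have "\<dots> = (\<Sum>i<?N. \<Sum>j<?N. poly_act D (?P $$ (j, l)) (poly_act D (?C $$ (i, j)) (?b ! i)))"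
      by (simp add: poly_act_sum poly_act_mult[symmetric] mult.commute)
    also have "\<dots> = (\<Sum>j<?N. poly_act D (?P $$ (j, l)) (\<Sum>i<?N. poly_act D (?C $$ (i, j)) (?b ! i)))"
      unfolding poly_act_sum_right by (rule sum.swap)
    also have "\<dots> = 0" by (simp add: col)
    finally show ?thesis .
  qed
  have "poly_act D (char_poly ?A) (\<Sum>i<?N. tscale (trunc_coord i f) (?b ! i)) = 0"
    by (simp add: poly_act_sum_right poly_act_tscale_right basis)
  then show ?thesis by (simp only: sum_trunc_coord)
qed

section \<open>Linear substitutions in the top monomial\<close>

lemma tconst_power: "tconst (c ^ m) = tconst c ^ m"
  by (induction m) (simp_all add: tconst_1 tconst_mult)

definition linear_form :: "('a::field_prime_char, 'n::finite) Finite_Cartesian_Product.vec \<Rightarrow> ('a, 'n) trunc" where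
  "linear_form v = (\<Sum>j\<in>UNIV. tconst (v $ j) * tvar j)"

lemma linear_form_add: "linear_form (v + w) = linear_form v + linear_form w"
  by (simp add: linear_form_def tconst_add distrib_right sum.distrib)

lemma linear_form_scale: "linear_form (c *s v) = tconst c * linear_form v"
  by (simp add: linear_form_def tconst_mult sum_distrib_left mult.assoc)

text \<open>Raising to the p-th power is additive in characteristic p and kills every
  variable.\<close>

lemma linear_form_power_CHAR: "linear_form (v :: ('a::field_prime_char, 'n::finite) Finite_Cartesian_Product.vec) ^ CHAR('a) = 0"
proof -
  have "linear_form v ^ CHAR('a) = (\<Sum>j\<in>UNIV. (tconst (v $ j) * tvar j) ^ CHAR('a))"
    unfolding linear_form_def by (rule freshmans_dream_sum) (simp_all add: CHAR_trunc prime_CHAR)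
  then show ?thesis
    by (simp add: power_mult_distrib tvar_power_CHAR)
qed

text \<open>Every binomial term containing \<open>b\<close> is killed by the extra factor
  \<open>b ^ k\<close>. With k = p - 1 and \<open>b\<close> a linear form this makes row operations
  invisible.\<close>

lemma power_add_multiple:
  fixes a b c :: "'a::comm_ring_1"
  assumes "b ^ Suc k = 0"
  shows "(a + c * b) ^ m * b ^ k = a ^ m * b ^ k"
proof (induction m)
  case (Suc m)
  have "(a + c * b) ^ Suc m * b ^ k = (a + c * b) * (a ^ m * b ^ k)"
    by (simp only: power_Suc mult.assoc Suc)
  also have "\<dots> = a ^ Suc m * b ^ k + c * a ^ m * b ^ Suc k"
    by (simp add: algebra_simps)
  finally show ?case by (simp only: assms mult_zero_right add_0_right)
qed simp

definition row_ops :: "'n set \<Rightarrow> ('n \<Rightarrow> 'a::comm_ring_1) \<Rightarrow> 'n::finite \<Rightarrow> ('a, 'n) sqmat \<Rightarrow> ('a, 'n) sqmat" where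
  "row_ops R c k A = (\<chi> i. if i \<in> R then A $ i + c i *s A $ k else A $ i)"

lemma det_row_ops:
  assumes "k \<notin> R"
  shows "det (row_ops R c k A) = det A"
proof -
  have "finite R" by simp
  then show ?thesis using assms
  proof (induction R rule: finite_induct)
    case empty
    then show ?case by (simp add: row_ops_def)
  next
    case (insert l R)
    then have "row_ops (insert l R) c k A = (\<chi> i. if i = l
        then row l (row_ops R c k A) + c l *s row k (row_ops R c k A) else row i (row_ops R c k A))"
      by (auto simp: row_ops_def row_def vec_eq_iff)
    then show ?case
      using insert det_row_operation[of l k "row_ops R c k A" "c l"] by auto
  qed
qed

definition top_power :: "('a::field_prime_char, 'n::finite) sqmat \<Rightarrow> ('a, 'n) trunc" where
  "top_power A = (\<Prod>i\<in>UNIV. linear_form (A $ i) ^ (CHAR('a) - 1))"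

text \<open>Row \<open>k\<close> is untouched, so the (p - 1)-st power of its linear form occurs in
  the product and absorbs all multiples of that form added elsewhere.\<close>

lemma top_power_row_ops:
  fixes A :: "('a::field_prime_char, 'n::finite) sqmat"
  assumes "k \<notin> R"
  shows "top_power (row_ops R c k A) = top_power A"
proof -
  let ?e = "CHAR('a) - 1" and ?b = "linear_form (A $ k)" and ?A' = "row_ops R c k A"
  have e: "Suc ?e = CHAR('a)" using CHAR_pos[where ?'a = 'a] by (simp del: CHAR_pos)
  have step: "linear_form (?A' $ i) ^ ?e * ?b ^ ?e = linear_form (A $ i) ^ ?e * ?b ^ ?e" for i
    using power_add_multiple[of ?b ?e "linear_form (A $ i)" "tconst (c i)" ?e] linear_form_power_CHAR[of "A $ k"]
    by (simp add: row_ops_def linear_form_add linear_form_scale e del: One_nat_def)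
  have "(\<Prod>i\<in>S. linear_form (?A' $ i) ^ ?e) * ?b ^ ?e = (\<Prod>i\<in>S. linear_form (A $ i) ^ ?e) * ?b ^ ?e"
    if "finite S" for S
    using that
  proof (induction S rule: finite_induct)
    case (insert i S)
    have "(\<Prod>i\<in>insert i S. linear_form (?A' $ i) ^ ?e) * ?b ^ ?e =
        linear_form (?A' $ i) ^ ?e * ((\<Prod>i\<in>S. linear_form (?A' $ i) ^ ?e) * ?b ^ ?e)"
      using insert by (simp add: mult.assoc)
    also have "\<dots> = (linear_form (?A' $ i) ^ ?e * ?b ^ ?e) * (\<Prod>i\<in>S. linear_form (A $ i) ^ ?e)"
      unfolding insert.IH by (simp add: mult_ac)
    also have "\<dots> = (\<Prod>i\<in>insert i S. linear_form (A $ i) ^ ?e) * ?b ^ ?e"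
      unfolding step using insert by (simp add: mult_ac)
    finally show ?case .
  qed simp
  from this[of "UNIV - {k}"] show ?thesis
    using assms by (simp add: top_power_def prod.remove[of UNIV k] mult.commute row_ops_def)
qed

text \<open>Gaussian elimination; the columns outside \<open>K\<close> are already diagonal.\<close>

lemma top_power_eq_det:
  fixes A :: "('a::field_prime_char, 'n::finite) sqmat"
  assumes "finite K" "det A \<noteq> 0" "\<And>i j. j \<notin> K \<Longrightarrow> i \<noteq> j \<Longrightarrow> A $ i $ j = 0"
  shows "top_power A = tconst (det A) ^ (CHAR('a) - 1) * tmonom (\<lambda>_. CHAR('a) - 1)"
  using assms
proof (induction K arbitrary: A rule: finite_induct)
  case empty
  have "linear_form (A $ i) = tconst (A $ i $ i) * tvar i" for i
  proof -
    have "linear_form (A $ i) = (\<Sum>j\<in>UNIV. if j = i then tconst (A $ i $ i) * tvar i else 0)"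
      unfolding linear_form_def using empty(2) by (intro sum.cong) (auto simp: tconst_0)
    then show ?thesis by simp
  qed
  moreover have "tconst (\<Prod>i\<in>S. A $ i $ i) = (\<Prod>i\<in>S. tconst (A $ i $ i) :: ('a, 'n) trunc)" for S
    by (induction S rule: infinite_finite_induct) (simp_all add: tconst_1 tconst_mult)
  ultimately show ?case
    using det_diagonal[of A] empty(2)
    by (simp add: top_power_def power_mult_distrib prod.distrib tmonom_def prod_power_distrib)
next
  case (insert k K)
  have pivot: "top_power B = tconst (det B) ^ (CHAR('a) - 1) * tmonom (\<lambda>_. CHAR('a) - 1)"
    if B: "det B \<noteq> 0" "\<And>i j. j \<notin> insert k K \<Longrightarrow> i \<noteq> j \<Longrightarrow> B $ i $ j = 0" "B $ k $ k \<noteq> 0"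
    for B :: "('a, 'n) sqmat"
  proof -
    let ?B' = "row_ops (UNIV - {k}) (\<lambda>i. - B $ i $ k / B $ k $ k) k B"
    have "?B' $ i $ j = 0" if "j \<notin> K" "i \<noteq> j" for i j
      using that B(2)[of j i] B(2)[of j k] B(3) by (cases "j = k") (auto simp: row_ops_def)
    then have "top_power ?B' = tconst (det ?B') ^ (CHAR('a) - 1) * tmonom (\<lambda>_. CHAR('a) - 1)"
      using B(1) by (intro insert.IH) (simp_all add: det_row_ops)
    then show ?thesis by (simp add: det_row_ops top_power_row_ops)
  qed
  show ?case
  proof (cases "A $ k $ k = 0")
    case False
    then show ?thesis using insert.prems by (intro pivot) auto
  next
    case kk: True
    show ?thesis
    proof (cases "\<exists>i\<in>K. A $ i $ k \<noteq> 0")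
      case True
      then obtain l where l: "l \<in> K" "A $ l $ k \<noteq> 0" by blast
      then have lk: "l \<notin> {k}" using insert.hyps by auto
      \<comment> \<open>Adding row \<open>l\<close> to row \<open>k\<close> creates a pivot. Since
        \<open>l\<close> lies in \<open>K\<close>, row \<open>l\<close> is zero in the columns
        outside \<open>insert k K\<close>, which stay diagonal.\<close>
      let ?A' = "row_ops {k} (\<lambda>_. 1) l A"
      have "?A' $ i $ j = 0" if "j \<notin> insert k K" "i \<noteq> j" for i j
        using that insert.prems(2)[of j i] insert.prems(2)[of j l] l(1)
        by (cases "l = j") (auto simp: row_ops_def)
      then have "top_power ?A' = tconst (det ?A') ^ (CHAR('a) - 1) * tmonom (\<lambda>_. CHAR('a) - 1)"
        using insert.prems(1) l kk by (intro pivot) (auto simp: det_row_ops[OF lk], auto simp: row_ops_def)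
      then show ?thesis by (simp add: det_row_ops[OF lk] top_power_row_ops[OF lk])
    next
      case False
      have diag: "A $ j $ j \<noteq> 0" if "j \<notin> insert k K" for j
      proof
        assume "A $ j $ j = 0"
        then have "column j A = 0"
          using insert.prems(2)[OF that] by (simp add: column_def vec_eq_iff) metis
        then show False using insert.prems(1) det_zero_column(2) by blast
      qed
      \<comment> \<open>Now column \<open>k\<close> is zero in all rows of
        \<open>insert k K\<close>, hence a combination of the diagonal columns outside;
        \<open>w\<close> is this dependence, and it cannot lie in the kernel of an invertible
        matrix.\<close>
      define w :: "'a ^ 'n" where
        "w = (\<chi> j. if j = k then 1 else if j \<in> K then 0 else - A $ j $ k / A $ j $ j)"
      have "(A *v w) $ i = 0" for i
      proof -
        have "(A *v w) $ i = A $ i $ k + (\<Sum>j\<in>UNIV - {k}. A $ i $ j * w $ j)"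
          by (simp add: matrix_vector_mult_def sum.remove[of UNIV k] w_def)
        also have "(\<Sum>j\<in>UNIV - {k}. A $ i $ j * w $ j) =
            (\<Sum>j\<in>UNIV - {k}. if j = i then if i \<in> K then 0 else - A $ i $ k else 0)"
          using insert.prems(2) diag by (intro sum.cong) (auto simp: w_def)
        also have "A $ i $ k + \<dots> = 0"
          using False kk by (cases "i = k") auto
        finally show ?thesis .
      qed
      then have "A *v w = 0" by (simp add: vec_eq_iff)
      moreover obtain B where "B ** A = mat 1"
        using insert.prems(1) by (auto simp: invertible_det_nz[symmetric] invertible_def)
      then have "w = B *v (A *v w)" by (simp add: matrix_vector_mul_assoc)
      ultimately have "w $ k = 0" by simp
      then show ?thesis by (simp add: w_def)
    qed
  qed
qed

text \<open>Wilson's theorem, the source of the sign (-1)^n in the formula for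
  \<open>Delta\<close>.\<close>

lemma of_nat_fact_CHAR: "of_nat (fact (CHAR('a) - 1)) = (- 1 :: 'a::field_prime_char)"
proof -
  have "[fact (CHAR('a) - 1) = (- 1 :: int)] (mod int CHAR('a))"
    by (rule wilson_theorem[OF prime_CHAR])
  then have "of_int (fact (CHAR('a) - 1) - (- 1)) = (0 :: 'a)"
    unfolding of_int_eq_0_iff_char_dvd by (simp only: cong_iff_dvd_diff)
  then have "of_int (fact (CHAR('a) - 1)) = (- 1 :: 'a)" by (simp add: eq_neg_iff_add_eq_0)
  moreover have "(fact (CHAR('a) - 1) :: int) = int (fact (CHAR('a) - 1))" by simp
  ultimately show ?thesis by (simp only: of_int_of_nat_eq)
qed

lemma digit_top:
  assumes "k < n" "p > 0"
  shows "digit p (p ^ n - 1) k = p - 1"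
proof -
  obtain m where n: "n = k + Suc m" using assms(1) less_iff_Suc_add[of k n] by auto
  have pos: "p ^ m > 0" "p ^ k > 0" using assms(2) by simp_all
  have eq: "p ^ n - 1 = (p ^ k - 1) + p ^ k * (p ^ Suc m - 1)"
    using pos assms(2) by (simp add: n power_add diff_mult_distrib2 mult_ac)
  have "(p ^ n - 1) div p ^ k = (p ^ Suc m - 1) + (p ^ k - 1) div p ^ k"
    unfolding eq by (rule div_mult_self2) (use pos in simp)
  also have "(p ^ k - 1) div p ^ k = 0" using pos by simp
  also have "p ^ Suc m - 1 + 0 = (p - 1) + p * (p ^ m - 1)"
    using pos assms(2) by (simp add: diff_mult_distrib2)
  finally have "digit p (p ^ n - 1) k = (p - 1) mod p"
    unfolding digit_def by (simp only: mod_mult_self2)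
  then show ?thesis using assms(2) by simp
qed

section \<open>The two formulas where \<open>Delta0\<close> does not vanish\<close>

context generic_witt
begin

text \<open>Apply D^(p^n - 1) to the top monomial in the coordinates and evaluate at the origin in
  two ways: the diagonal entry of the triangular matrix is (p - 1)! to the power n, while rewriting
  the monomial in the variables gives det(M)^(1-p) times \<open>Delta D\<close>.\<close>

lemma Delta0_power: "Delta0 D ^ (CHAR('a) - 1) = (- 1) ^ CARD('n) * Delta D"
proof -
  let ?N = "CHAR('a) ^ CARD('n) - 1" and ?e = "CHAR('a) - 1"
  \<comment> \<open>The coefficients of \<open>coord k\<close> form a column of the inverse matrix,
    whereas \<open>top_power\<close> takes linear forms from rows.\<close>
  let ?Q = "transpose (matrix_inv M)"
  have N: "?N < CHAR('a) ^ CARD('n)" by simp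
  have inv: "det M * det ?Q = 1"
    using arg_cong[OF M_inverse, of det] by (simp add: det_mul)
  then have Q: "det ?Q \<noteq> 0" by auto
  have "coord_monom ?N = (\<Prod>k<CARD('n). coord k ^ ?e)"
    unfolding coord_monom_def by (intro prod.cong) (simp_all add: digit_top[simplified] CHAR_pos)
  also have "\<dots> = (\<Prod>k<CARD('n). linear_form (?Q $ nth_var k) ^ ?e)"
    by (simp add: coord_def linear_form_def transpose_def)
  also have "\<dots> = top_power ?Q"
    unfolding top_power_def by (rule prod.reindex_bij_betw[OF bij_nth_var])
  also have "\<dots> = tconst (det ?Q) ^ ?e * tmonom (\<lambda>_. ?e)"
    using top_power_eq_det[of UNIV ?Q] Q by simp
  also have "tconst (det ?Q) ^ ?e = (tconst (det ?Q ^ ?e) :: ('a, 'n) trunc)"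
    by (simp only: tconst_power)
  finally have "coord_monom ?N = tscale (det ?Q ^ ?e) (tmonom (\<lambda>_. ?e))"
    by (simp add: tscale_def)
  then have "ev ((der_apply D ^^ ?N) (coord_monom ?N)) = det ?Q ^ ?e * Delta D"
    by (simp add: funpow_der_tscale Delta_def eval0_eq_ev)
  moreover have "ev ((der_apply D ^^ ?N) (coord_monom ?N)) = (- 1) ^ CARD('n)"
    using ev_funpow_coord_monom[OF N N order.refl]
    by (simp add: digit_top CHAR_pos of_nat_prod of_nat_fact_CHAR del: of_nat_fact One_nat_def)
  ultimately have "(- 1) ^ CARD('n) = det ?Q ^ ?e * Delta D" by simp
  then have "det M ^ ?e * (- 1) ^ CARD('n) = (det M * det ?Q) ^ ?e * Delta D"
    by (simp add: power_mult_distrib mult_ac)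
  then have Delta: "Delta D = det M ^ ?e * (- 1) ^ CARD('n)" using inv by simp
  have "(- 1) ^ CARD('n) * (- 1) ^ CARD('n) = (1 :: 'a)"
    by (simp flip: power_mult_distrib)
  then show ?thesis by (simp add: Delta det_M mult_ac)
qed

lemma psi_Delta0:
  assumes "m < CARD('n)"
  shows "psi m D * Delta0 D = - Delta_repl (Suc m) D"
proof -
  let ?p = "CHAR('a)" and ?n = "CARD('n)"
  have p1: "?p > 1" using prime_CHAR[where ?'a = 'a] prime_gt_1_nat by blast
  let ?y = "const_part (ppow ?n D)"
  \<comment> \<open>The constant parts of the powers of \<open>D\<close> are the rows of
    \<open>M\<close>; expressing \<open>?y\<close> by them is a linear system for the
    transpose.\<close>
  have "invertible (transpose M)"
    unfolding invertible_det_nz using Delta0_nonzero by (simp add: det_M)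
  then obtain B where "transpose M ** B = mat 1"
    unfolding invertible_def by blast
  then have "transpose M *v (B *v ?y) = ?y" by (simp add: matrix_vector_mul_assoc)
  then obtain c where c: "transpose M *v c = ?y" by blast
  have y: "?y = (\<Sum>i\<in>UNIV. c $ i *s row i M)"
    unfolding c[symmetric] by (simp add: vec_eq_iff matrix_vector_mult_def transpose_def row_def mult.commute)
  define E where "E = ppow ?n D - (\<Sum>i\<in>UNIV. wscale (c $ i) (ppow (var_index i) D))"
  have "const_part E = 0"
    unfolding vec_eq_iff
  proof
    fix j
    have "const_part E $ j = ?y $ j - (\<Sum>i\<in>UNIV. c $ i * M $ i $ j)"
      by (simp add: E_def const_part_def M_def)
    then show "const_part E $ j = 0 $ j" by (simp add: y row_def)
  qed
  from ev_der_apply_eq_0[OF this]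
  have top: "ev ((der_apply D ^^ (?p ^ ?n)) f) =
      (\<Sum>i\<in>UNIV. c $ i * ev ((der_apply D ^^ (?p ^ var_index i)) f))" for f
    by (simp add: E_def der_apply_ppow)
  define cp where "cp = char_poly (basis_mat D)"
  have len: "length (trunc_basis :: ('a, 'n) trunc list) = ?p ^ ?n"
    using card_basis(2)[OF trunc_basis(2,3)] distinct_card[OF trunc_basis(1), where ?'a1 = 'a and ?'n1 = 'n] by simp
  have deg: "degree cp = ?p ^ ?n" "coeff cp (?p ^ ?n) = 1"
    unfolding cp_def using degree_monic_char_poly[OF basis_mat_carrier[of D]] by (simp_all add: len)
  \<comment> \<open>Coefficients left after the relation from \<open>E\<close> is used to replace
    D^(p^n) in the Cayley-Hamilton relation; only exponents below p^n remain.\<close>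
  define d where "d = (\<lambda>k. coeff cp k + (\<Sum>i\<in>UNIV. if k = ?p ^ var_index (i :: 'n) then c $ i else 0))"
  have lt: "?p ^ var_index (i :: 'n) < ?p ^ ?n" for i
    using p1 by (intro power_strict_increasing) simp_all
  have "(\<Sum>k<?p ^ ?n. d k * ev ((der_apply D ^^ k) f)) = 0" for f
  proof -
    have "(\<Sum>k<?p ^ ?n. d k * ev ((der_apply D ^^ k) f)) =
      (\<Sum>k<?p ^ ?n. coeff cp k * ev ((der_apply D ^^ k) f)) +
      (\<Sum>k<?p ^ ?n. \<Sum>i\<in>UNIV. if k = ?p ^ var_index (i :: 'n) then c $ i * ev ((der_apply D ^^ k) f) else 0)"
      by (simp add: d_def distrib_right sum.distrib sum_distrib_right mult_delta_left)
    also have "(\<Sum>k<?p ^ ?n. \<Sum>i\<in>UNIV. if k = ?p ^ var_index (i :: 'n) then c $ i * ev ((der_apply D ^^ k) f) else 0) =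
      (\<Sum>i\<in>UNIV. \<Sum>k<?p ^ ?n. if k = ?p ^ var_index (i :: 'n) then c $ i * ev ((der_apply D ^^ k) f) else 0)"
      by (rule sum.swap)
    also have "\<dots> = ev ((der_apply D ^^ (?p ^ ?n)) f)"
      by (simp add: top lt)
    also have "(\<Sum>k<?p ^ ?n. coeff cp k * ev ((der_apply D ^^ k) f)) + \<dots> = ev (poly_act D cp f)"
      by (simp add: poly_act_def deg lessThan_Suc_atMost[symmetric])
    finally show ?thesis by (simp add: cp_def cayley_hamilton)
  qed
  from ev_funpow_independent[OF this lt] have "d (?p ^ var_index i) = 0" for i :: 'n .
  moreover have "?p ^ var_index i = ?p ^ var_index j \<longleftrightarrow> i = j" for i j :: 'n
    using p1 by (simp add: power_inject_exp)
  ultimately have "coeff cp (?p ^ var_index i) = - c $ i" for i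
    by (simp add: d_def eq_neg_iff_add_eq_0)
  from this[of "nth_var m"] have "psi m D = - c $ nth_var m"
    using assms by (simp add: psi_def endo_char_poly_eq cp_def)
  moreover have "Delta_repl (Suc m) D = c $ nth_var m * det M"
  proof -
    have "var_index i = m \<longleftrightarrow> i = nth_var m" for i :: 'n
      using assms by (metis index_nth_var nth_var_index)
    then have "Delta_repl (Suc m) D = det (\<chi> i. if i = nth_var m
        then (\<Sum>i\<in>UNIV. c $ i *s row i M) else row i M)"
      unfolding Delta_repl_eq_det y[symmetric] by (simp add: M_def row_def cong: if_cong)
    then show ?thesis by (simp add: cramer_lemma_transpose)
  qed
  ultimately show ?thesis by (simp add: det_M)
qed

end

section \<open>Zariski density\<close>

text \<open>The argument is the parameter of a line in the space of derivations, so one variable is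
  enough.\<close>

definition poly_fun :: "('a::comm_ring_1 \<Rightarrow> 'a) \<Rightarrow> bool" where
  "poly_fun f \<longleftrightarrow> (\<exists>P. \<forall>s. f s = poly P s)"

lemma poly_fun_const [intro]: "poly_fun (\<lambda>s. c)"
  unfolding poly_fun_def by (rule exI[of _ "[:c:]"]) simp
lemma poly_fun_ident [intro]: "poly_fun (\<lambda>s. s)"
  unfolding poly_fun_def by (rule exI[of _ "[:0, 1:]"]) simp
lemma poly_fun_add [intro]: "poly_fun f \<Longrightarrow> poly_fun g \<Longrightarrow> poly_fun (\<lambda>s. f s + g s)"
  unfolding poly_fun_def by (metis poly_add)
lemma poly_fun_diff [intro]: "poly_fun f \<Longrightarrow> poly_fun g \<Longrightarrow> poly_fun (\<lambda>s. f s - g s)"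
  unfolding poly_fun_def by (metis poly_diff)
lemma poly_fun_mult [intro]: "poly_fun f \<Longrightarrow> poly_fun g \<Longrightarrow> poly_fun (\<lambda>s. f s * g s)"
  unfolding poly_fun_def by (metis poly_mult)
lemma poly_fun_power [intro]: "poly_fun f \<Longrightarrow> poly_fun (\<lambda>s. f s ^ m)"
  by (induction m) auto
lemma poly_fun_sum [intro]: "(\<And>i. i \<in> A \<Longrightarrow> poly_fun (f i)) \<Longrightarrow> poly_fun (\<lambda>s. \<Sum>i\<in>A. f i s)"
  by (induction A rule: infinite_finite_induct) auto
lemma poly_fun_prod [intro]: "(\<And>i. i \<in> A \<Longrightarrow> poly_fun (f i)) \<Longrightarrow> poly_fun (\<lambda>s. \<Prod>i\<in>A. f i s)"
  by (induction A rule: infinite_finite_induct) auto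

lemma poly_fun_det:
  fixes A :: "'a::comm_ring_1 \<Rightarrow> ('a, 'n::finite) sqmat"
  assumes "\<And>i j. poly_fun (\<lambda>s. A s $ i $ j)"
  shows "poly_fun (\<lambda>s. det (A s))"
  unfolding det_def by (intro poly_fun_sum poly_fun_mult poly_fun_prod poly_fun_const assms)

text \<open>Polynomials in t whose coefficients depend polynomially on the parameter s.\<close>

definition poly_fun_coeffs :: "('a::comm_ring_1 \<Rightarrow> 'a poly) \<Rightarrow> bool" where
  "poly_fun_coeffs f \<longleftrightarrow> (\<forall>i. poly_fun (\<lambda>s. coeff (f s) i))"

lemma poly_fun_coeffs_const [intro]: "poly_fun_coeffs (\<lambda>s. q)"
  by (auto simp: poly_fun_coeffs_def)
lemma poly_fun_coeffs_add [intro]: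
  "poly_fun_coeffs f \<Longrightarrow> poly_fun_coeffs g \<Longrightarrow> poly_fun_coeffs (\<lambda>s. f s + g s)"
  by (auto simp: poly_fun_coeffs_def)
lemma poly_fun_coeffs_mult [intro]:
  "poly_fun_coeffs f \<Longrightarrow> poly_fun_coeffs g \<Longrightarrow> poly_fun_coeffs (\<lambda>s. f s * g s)"
  unfolding poly_fun_coeffs_def coeff_mult by (intro allI poly_fun_sum poly_fun_mult) blast+
lemma poly_fun_coeffs_sum [intro]:
  "(\<And>i. i \<in> A \<Longrightarrow> poly_fun_coeffs (f i)) \<Longrightarrow> poly_fun_coeffs (\<lambda>s. \<Sum>i\<in>A. f i s)"
  by (induction A rule: infinite_finite_induct) auto
lemma poly_fun_coeffs_prod [intro]:
  "(\<And>i. i \<in> A \<Longrightarrow> poly_fun_coeffs (f i)) \<Longrightarrow> poly_fun_coeffs (\<lambda>s. \<Prod>i\<in>A. f i s)"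
  by (induction A rule: infinite_finite_induct) auto

text \<open>Expand the determinant over permutations: sums and products preserve polynomial
  dependence of the coefficients.\<close>

lemma poly_fun_char_poly:
  fixes A :: "'a::comm_ring_1 \<Rightarrow> 'a Matrix.mat"
  assumes A: "\<And>s. A s \<in> carrier_mat N N"
    and entries: "\<And>i j. i < N \<Longrightarrow> j < N \<Longrightarrow> poly_fun (\<lambda>s. A s $$ (i, j))"
  shows "poly_fun (\<lambda>s. coeff (char_poly (A s)) m)"
proof -
  have dim: "dim_row (A s) = N" "dim_col (A s) = N" for s using A[of s] by auto
  have C: "poly_fun_coeffs (\<lambda>s. char_poly_matrix (A s) $$ (i, j))" if "i < N" "j < N" for i j
  proof -
    have "char_poly_matrix (A s) $$ (i, j) = (if i = j then [:0, 1:] else 0) + [:- (A s $$ (i, j)):]" for s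
      using that by (simp add: char_poly_matrix_def dim)
    moreover have "poly_fun (\<lambda>s. - (A s $$ (i, j)))"
      using poly_fun_diff[OF poly_fun_const[of 0] entries[OF that]] by simp
    then have "poly_fun (\<lambda>s. coeff [:- (A s $$ (i, j)):] m)" for m
      by (cases m) (simp_all add: poly_fun_const)
    then have "poly_fun_coeffs (\<lambda>s. [:- (A s $$ (i, j)):])"
      by (simp add: poly_fun_coeffs_def)
    ultimately show ?thesis by (simp only: poly_fun_coeffs_add poly_fun_coeffs_const)
  qed
  have "char_poly (A s) = (\<Sum>q\<in>{q. q permutes {0..<N}}. signof q *
      (\<Prod>i = 0..<N. char_poly_matrix (A s) $$ (i, q i)))" for s
    unfolding char_poly_def by (rule det_def') (use A in auto)
  moreover have "q i < N" if "q permutes {0..<N}" "i < N" for q i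
    using that permutes_in_image[of q "{0..<N}" i] by simp
  ultimately have "poly_fun_coeffs (\<lambda>s. char_poly (A s))"
    using C by (auto intro!: poly_fun_coeffs_sum poly_fun_coeffs_mult poly_fun_coeffs_prod)
  then show ?thesis by (simp add: poly_fun_coeffs_def)
qed

text \<open>The maps sending s to a finite sum of s^i f_i with f_i in the truncated ring, in Horner
  form. The rules match the action of D + s E, which adds and scales by s.\<close>

inductive trunc_poly_fun :: "('a::field_prime_char \<Rightarrow> ('a, 'n::finite) trunc) \<Rightarrow> bool" where
  const: "trunc_poly_fun (\<lambda>s. f)"
| add: "trunc_poly_fun F \<Longrightarrow> trunc_poly_fun G \<Longrightarrow> trunc_poly_fun (\<lambda>s. F s + G s)"
| scale: "trunc_poly_fun F \<Longrightarrow> trunc_poly_fun (\<lambda>s. tscale s (F s))"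

lemma trunc_poly_fun_der: "trunc_poly_fun F \<Longrightarrow> trunc_poly_fun (\<lambda>s. der_apply D (F s))"
  by (induction rule: trunc_poly_fun.induct) (auto intro: trunc_poly_fun.intros)

lemma trunc_poly_fun_functional:
  assumes "\<And>f g. \<phi> (f + g) = \<phi> f + \<phi> g" "\<And>c f. \<phi> (tscale c f) = c * \<phi> f"
  shows "trunc_poly_fun F \<Longrightarrow> poly_fun (\<lambda>s. \<phi> (F s))"
  by (induction rule: trunc_poly_fun.induct) (auto simp: assms)

lemma trunc_poly_fun_funpow: "trunc_poly_fun (\<lambda>s. (der_apply (D + wscale s E) ^^ m) f)"
proof (induction m)
  case 0
  show ?case by (simp add: trunc_poly_fun.const)
next
  case (Suc m)
  then show ?case
    using trunc_poly_fun.add[OF trunc_poly_fun_der[OF Suc, of D]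
        trunc_poly_fun.scale[OF trunc_poly_fun_der[OF Suc, of E]]]
    by simp
qed

lemma poly_fun_ev_funpow: "poly_fun (\<lambda>s. ev ((der_apply (D + wscale s E) ^^ m) f))"
  by (rule trunc_poly_fun_functional[OF _ _ trunc_poly_fun_funpow]) simp_all

lemma poly_fun_Delta0: "poly_fun (\<lambda>s. Delta0 (D + wscale s E))"
  unfolding Delta0_eq_det
  by (rule poly_fun_det) (simp add: const_part_def der_apply_ppow poly_fun_ev_funpow)

lemma poly_fun_Delta_repl: "poly_fun (\<lambda>s. Delta_repl i (D + wscale s E))"
  unfolding Delta_repl_eq_det
proof (rule poly_fun_det)
  fix k j :: 'b
  show "poly_fun (\<lambda>s. (\<chi> k. if var_index k = i - 1 then const_part (ppow CARD('b) (D + wscale s E))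
      else const_part (ppow (var_index k) (D + wscale s E))) $ k $ j)"
    by (cases "var_index k = i - 1") (simp_all add: const_part_def der_apply_ppow poly_fun_ev_funpow)
qed

lemma poly_fun_Delta: "poly_fun (\<lambda>s. Delta (D + wscale s E))"
  unfolding Delta_def eval0_eq_ev by (rule poly_fun_ev_funpow)

lemma poly_fun_psi: "poly_fun (\<lambda>s. psi m (D + wscale s E))"
  unfolding psi_def endo_char_poly_eq
proof (rule poly_fun_char_poly[OF basis_mat_carrier])
  fix i j
  assume ij: "i < length (trunc_basis :: ('a, 'b) trunc list)" "j < length (trunc_basis :: ('a, 'b) trunc list)"
  have "poly_fun (\<lambda>s. trunc_coord i ((der_apply (D + wscale s E) ^^ 1) (trunc_basis ! j)))"
    by (rule trunc_poly_fun_functional[OF _ _ trunc_poly_fun_funpow])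
      (simp_all add: trunc_coord_add trunc_coord_tscale)
  then show "poly_fun (\<lambda>s. basis_mat (D + wscale s E) $$ (i, j))"
    using ij by (simp add: basis_mat_def)
qed

text \<open>Over a finite field, one plus the product of all linear factors would be a nonconstant
  polynomial without roots.\<close>

lemma infinite_alg_closed: "infinite (UNIV :: 'a::alg_closed_field set)"
proof
  assume fin: "finite (UNIV :: 'a set)"
  let ?P = "(\<Prod>a\<in>(UNIV :: 'a set). [:- a, 1:])"
  have "degree ?P = card (UNIV :: 'a set)"
    by (subst degree_prod_eq_sum_degree) simp_all
  moreover have "card (UNIV :: 'a set) > 0" using fin by (simp add: card_gt_0_iff)
  ultimately have "degree (?P + 1) > 0" by (subst degree_add_eq_left) simp_all
  then obtain x where "poly (?P + 1) x = 0" using alg_closed_imp_poly_has_root by blast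
  moreover have "poly ?P x = 0" using fin by (auto simp: poly_prod)
  ultimately show False by simp
qed

text \<open>On the line from \<open>D\<close> to \<open>E\<close> the polynomial of
  \<open>Delta0\<close> is nonzero, by its value at s = 1, while its product with that of
  \<open>H\<close> vanishes everywhere. Hence \<open>H\<close> is zero on the whole line, in
  particular at s = 0.\<close>

lemma Delta0_dense:
  fixes H :: "('a::{alg_closed_field,field_prime_char}, 'n::{finite,linorder}) witt \<Rightarrow> 'a"
    and D E :: "('a, 'n) witt"
  assumes H: "\<And>D E. poly_fun (\<lambda>s. H (D + wscale s E))" and E: "Delta0 E \<noteq> 0"
    and zero: "\<And>D. Delta0 D \<noteq> 0 \<Longrightarrow> H D = 0"
  shows "H D = 0"
proof -
  obtain P Q where P: "\<And>s. Delta0 (D + wscale s (E - D)) = poly P s"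
    and Q: "\<And>s. H (D + wscale s (E - D)) = poly Q s"
    using poly_fun_Delta0[of D "E - D"] H[of D "E - D"] unfolding poly_fun_def by blast
  have "poly P 1 \<noteq> 0" using P[of 1] E by simp
  then have "P \<noteq> 0" by auto
  have "poly (P * Q) s = 0" for s
    using zero[of "D + wscale s (E - D)"] by (auto simp flip: P Q)
  then have "P * Q = 0"
    using poly_roots_finite[of "P * Q"] infinite_alg_closed[where ?'a = 'a] by auto
  then have "Q = 0" using \<open>P \<noteq> 0\<close> by simp
  then show ?thesis using Q[of 0] by simp
qed

section \<open>A toral element\<close>

text \<open>Only the roots of finitely many nonzero polynomials t^(p^l) - t^(p^k) have to be
  avoided.\<close>

lemma exists_distinct_frobenius_powers:
  "\<exists>\<mu> :: 'a::{alg_closed_field,field_prime_char}. inj_on (\<lambda>k. \<mu> ^ (CHAR('a) ^ k)) {..<n}"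
proof -
  define S where "S = {(k, l). k < l \<and> l < n}"
  define q where "q = (\<lambda>(k, l). monom 1 (CHAR('a) ^ l) - monom (1 :: 'a) (CHAR('a) ^ k))"
  have fin: "finite S"
    unfolding S_def by (rule finite_subset[of _ "{..<n} \<times> {..<n}"]) auto
  have p1: "CHAR('a) > 1" using prime_CHAR[where ?'a = 'a] prime_gt_1_nat by blast
  have "q (k, l) \<noteq> 0" if "k < l" for k l
  proof -
    have "CHAR('a) ^ k \<noteq> CHAR('a) ^ l" using that p1 by (simp add: power_inject_exp)
    then have "coeff (q (k, l)) (CHAR('a) ^ l) = 1" by (simp add: q_def)
    then show ?thesis by (metis coeff_0 zero_neq_one)
  qed
  then have "prod q S \<noteq> 0" using fin by (auto simp: S_def)
  then obtain \<mu> where "\<mu> \<notin> {x. poly (prod q S) x = 0}"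
    using ex_new_if_finite[OF infinite_alg_closed poly_roots_finite] by blast
  then have "poly (q (k, l)) \<mu> \<noteq> 0" if "k < l" "l < n" for k l
    using that fin by (auto simp: poly_prod S_def)
  then have "\<mu> ^ (CHAR('a) ^ l) \<noteq> \<mu> ^ (CHAR('a) ^ k)" if "k < l" "l < n" for k l
    using that by (force simp: q_def poly_monom)
  then have "inj_on (\<lambda>k. \<mu> ^ (CHAR('a) ^ k)) {..<n}"
    by (intro inj_onI) (metis lessThan_iff linorder_neqE_nat)
  then show ?thesis ..
qed

text \<open>A kernel vector is the coefficient vector of a polynomial of degree less than n with n
  distinct roots.\<close>

lemma vandermonde_nonzero:
  fixes y :: "'n::{finite,linorder} \<Rightarrow> 'a::field"
  assumes "inj y"
  shows "det ((\<chi> i j. y i ^ var_index j) :: ('a, 'n) sqmat) \<noteq> 0"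
proof -
  let ?V = "(\<chi> i j. y i ^ var_index j) :: ('a, 'n) sqmat"
  have "w = 0" if w: "?V *v w = 0" for w
  proof -
    let ?Q = "\<Sum>j\<in>UNIV. monom (w $ j) (var_index j)"
    have "poly ?Q (y i) = 0" for i
      using w by (simp add: vec_eq_iff matrix_vector_mult_def poly_sum poly_monom mult.commute)
    then have roots: "range y \<subseteq> {x. poly ?Q x = 0}" by auto
    have "degree ?Q \<le> CARD('n) - 1"
    proof (rule degree_sum_le)
      fix j :: 'n
      show "degree (monom (w $ j) (var_index j)) \<le> CARD('n) - 1"
        using degree_monom_le[of "w $ j" "var_index j"] var_index_less[of j] by linarith
    qed simp
    moreover have "card {x. poly ?Q x = 0} \<ge> CARD('n)" if "?Q \<noteq> 0"
      using card_mono[OF poly_roots_finite[OF that] roots] card_image[OF assms] by simp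
    moreover have "CARD('n) > 0" by simp
    ultimately have "?Q = 0" using card_poly_roots_bound[of ?Q] by linarith
    then have "coeff ?Q (var_index j) = 0" for j :: 'n by simp
    then have "w $ j = 0" for j by (simp add: coeff_sum)
    then show "w = 0" by (simp add: vec_eq_iff)
  qed
  then have "invertible ?V"
    by (simp add: invertible_left_inverse matrix_left_invertible_ker)
  then show ?thesis by (simp add: invertible_det_nz)
qed

lemma exists_Delta0_nonzero:
  "\<exists>D :: ('a::{alg_closed_field,field_prime_char}, 'n::{finite,linorder}) witt. Delta0 D \<noteq> 0"
proof -
  let ?p = "CHAR('a)"
  obtain \<mu> :: 'a where inj: "inj_on (\<lambda>k. \<mu> ^ (?p ^ k)) {..<CARD('n)}"
    using exists_distinct_frobenius_powers by blast
  \<comment> \<open>Each 1 + x_i is an eigenvector with eigenvalue \<mu>^i, where i is the index of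
    the variable, so all powers of \<open>D\<close> are explicit. The shift by 1 makes the constant
    parts nonzero; a diagonal field in the x_i themselves would vanish at the origin.\<close>
  define D :: "('a, 'n) witt" where
    "D = (\<Sum>i\<in>UNIV. wmult (tconst (\<mu> ^ var_index i) * (1 + tvar i)) (partial i))"
  have D: "der_apply D (tvar i) = tconst (\<mu> ^ var_index i) * (1 + tvar i)" for i
    by (simp add: D_def der_apply_partial mult_delta_right)
  have pow: "(der_apply D ^^ Suc m) (tvar i) = tconst ((\<mu> ^ var_index i) ^ Suc m) * (1 + tvar i)" for m i
  proof (induction m)
    case (Suc m)
    have "(der_apply D ^^ Suc (Suc m)) (tvar i) = der_apply D ((der_apply D ^^ Suc m) (tvar i))"
      by simp
    also have "\<dots> = tconst ((\<mu> ^ var_index i) ^ Suc m) * (tconst (\<mu> ^ var_index i) * (1 + tvar i))"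
      by (simp only: Suc der_apply_tconst_mult der_apply_add der_apply_1 D add_0)
    finally show ?case by (simp add: tconst_mult mult_ac)
  qed (simp add: D)
  \<comment> \<open>The exponent must be positive: the zeroth power fixes x_i, whose value at the
    origin is 0.\<close>
  have ev_pow: "ev ((der_apply D ^^ (?p ^ k)) (tvar i)) = (\<mu> ^ var_index i) ^ (?p ^ k)" for k i
  proof -
    obtain m where "?p ^ k = Suc m"
      using gr0_implies_Suc[of "?p ^ k"] CHAR_pos[where ?'a = 'a] by auto
    then show ?thesis by (simp only: pow) simp
  qed
  \<comment> \<open>Interchanging the two exponents exhibits a Vandermonde matrix in the Frobenius
    powers of \<mu>.\<close>
  have "Delta0 D = det ((\<chi> i j. (\<mu> ^ (?p ^ var_index i)) ^ var_index j) :: ('a, 'n) sqmat)"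
    by (simp add: Delta0_eq_det const_part_def der_apply_ppow ev_pow power_mult[symmetric] mult.commute)
  moreover have "inj (\<lambda>i :: 'n. \<mu> ^ (?p ^ var_index i))"
    using inj by (intro injI) (auto dest: inj_onD)
  ultimately show ?thesis using vandermonde_nonzero by metis
qed

theorem proposition1:
  fixes p n :: nat
  assumes "CHAR('a::{alg_closed_field,field_prime_char}) = p"
    and "p > 2"
    and "CARD('n::{finite,linorder}) = n"
    and "n \<ge> 1"
    and "(p, n) \<noteq> (3, 1)"
  shows "(\<forall>D::('a, 'n) witt. Delta0 D ^ (p - 1) = (-1) ^ n * Delta D)
    \<and> (\<exists>D::('a, 'n) witt. Delta0 D \<noteq> 0)
    \<and> (\<forall>i\<in>{1..n}. \<forall>D::('a, 'n) witt. psi (i - 1) D * Delta0 D = - Delta_repl i D)"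
proof (intro conjI ballI allI)
  obtain E :: "('a, 'n) witt" where E: "Delta0 E \<noteq> 0"
    using exists_Delta0_nonzero by blast
  then show "\<exists>D::('a, 'n) witt. Delta0 D \<noteq> 0" ..
  have generic: "generic_witt D" if "Delta0 D \<noteq> 0" for D :: "('a, 'n) witt"
    using that by unfold_locales
  show "Delta0 D ^ (p - 1) = (-1) ^ n * Delta D" for D :: "('a, 'n) witt"
  proof -
    \<comment> \<open>The difference of the two sides is polynomial along lines and vanishes
      wherever \<open>Delta0\<close> does not, so density applies.\<close>
    let ?H = "\<lambda>D :: ('a, 'n) witt. Delta0 D ^ (p - 1) - (-1) ^ n * Delta D"
    have "poly_fun (\<lambda>s. ?H (D + wscale s E))" for D E
      by (intro poly_fun_diff poly_fun_power poly_fun_mult poly_fun_const poly_fun_Delta0 poly_fun_Delta)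
    moreover have "?H D = 0" if "Delta0 D \<noteq> 0" for D
      using generic_witt.Delta0_power[OF generic[OF that]] assms(1,3) by simp
    ultimately have "?H D = 0" by (rule Delta0_dense[OF _ E])
    then show ?thesis by simp
  qed
  show "psi (i - 1) D * Delta0 D = - Delta_repl i D" if "i \<in> {1..n}" for i and D :: "('a, 'n) witt"
  proof -
    let ?H = "\<lambda>D :: ('a, 'n) witt. psi (i - 1) D * Delta0 D + Delta_repl i D"
    \<comment> \<open>Wedge factors are numbered from 1, but matrix rows and the exponents k in
      D^(p^k) from 0.\<close>
    have i: "i - 1 < CARD('n)" "Suc (i - 1) = i" using that assms(3) by auto
    have "poly_fun (\<lambda>s. ?H (D + wscale s E))" for D E
      by (intro poly_fun_add poly_fun_mult poly_fun_psi poly_fun_Delta0 poly_fun_Delta_repl)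
    moreover have "?H D = 0" if "Delta0 D \<noteq> 0" for D
      using generic_witt.psi_Delta0[OF generic[OF that] i(1)] unfolding i(2) by simp
    ultimately have "?H D = 0" by (rule Delta0_dense[OF _ E])
    then show ?thesis by (simp only: eq_neg_iff_add_eq_0)
  qed
qed

end
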